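(* Let $f\colon \mathbb{N}\to [0,1]$, and suppose $\mathbf{N} = (N_s)_{s \in \mathbb{N}}$ and $\mathbf{H}=(H_s)_{s\in\mathbb{N}}$ are sequences in $\mathbb{N}$ with $1\prec \mathbf{H}\prec \mathbf{N}$ and $\lim_{s\to\infty} N_s/N_{s+1}=0$. Suppose $(\mathbf{N},\mathbf{H})$ is a $U^2$ good scale for $f$ and $f = f_{\mathrm{str}} + f_{\mathrm{unf}}$ is a decomposition witnessing this. Then there exists a sequence $\epsilon_s \to 0$ such that for every $s\in\mathbb{N}$ and every $n\in \{N_{s-1}+1,\ldots,N_s\}$ there is $Q_n\in\mathbb{N}$ with $H_s\leq Q_n\leq (1+\epsilon_s)H_s$, such that $\lim_{n \to \infty} \min\{m \in \mathbb{N} : m \nmid Q_n\} = \infty$ and \[ \lim_{s\to\infty}\frac{1}{N_s}\sum_{n=1}^{N_s}\frac{1}{H_s}\sum_{h=0}^{H_s-1} |f_{\mathrm{str}}(n+h)-f_{\mathrm{str}}(n+h+Q_n)|=0. \]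
   Context: $N_0=0$, $[L]=\{1,\dots,L\}$. Sequence order: $1\prec\mathbf{H}$ means $H_s\to\infty$; $\mathbf{H}\prec\mathbf{N}$ means $H_s/N_s\to0$. $e(x)=e^{2\pi ix}$, $\|x\|_{\mathbb{T}}$ = distance to nearest integer, $\mathbb{E}_{n\in\mathbf{N}}a(n)=\lim_s\frac1{N_s}\sum_{n=1}^{N_s}a(n)$, $\|g\|_{2,\mathbf{N}}=(\mathbb{E}_{n\in\mathbf{N}}|g|^2)^{1/2}$. Gowers norm: $\|u\|^4_{U^2(\mathbb{Z}/M\mathbb{Z})}=M^{-3}\sum_{x,h_1,h_2}u(x)\overline{u(x+h_1)u(x+h_2)}u(x+h_1+h_2)$; $\|g\|_{U^2(\{x+1,\dots,x+L\})}=\|\tilde g\|_{U^2(\mathbb{Z}/M\mathbb{Z})}/\|1_{[L]}\|_{U^2(\mathbb{Z}/M\mathbb{Z})}$ with $M\ge4L$, $\tilde g(n)=1_{[L]}(n)g(x+n)$; $\|g\|_{U^2(\mathbf{N},\mathbf{H})}=\lim_s\frac1{N_s-H_s+1}\sum_{n=1}^{N_s-H_s+1}\|g\|_{U^2(\{n,\dots,n+H_s-1\})}$. $(\mathbf{N},\mathbf{H})$ is a $U^2$ good scale for $f$ if $f=f_{\mathrm{str}}+f_{\mathrm{unf}}$ with: (i) $f_{\mathrm{str}}\in[0,1]$, $\mathbb{E}_{n\in\mathbf{N}}f_{\mathrm{unf}}=0$; (ii) for every $\epsilon>0$ there are $d$, $c_i\colon\mathbb{N}\to\mathbb{C}$ with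 $\|c_i\|_\infty\le1$ and $\alpha_i\colon\mathbb{N}\to\mathbb{R}$ ($i\le d$) with $\|\sum_ic_i(n)e(n\alpha_i(n))-f_{\mathrm{str}}\|_{2,\mathbf{N}}\le\epsilon$, such that for every $C\ge1$ the sets of $n\in[N_s-H_s+1]$ on which all $\alpha_i(n+\cdot)$ are constant on $[H_s]$, on which all $c_i(n+\cdot)$ are constant on $[H_s]$, and on which every $w\in[-C,C]^d\cap\mathbb{Z}^d$ has $\|\sum w_i\alpha_i(n)\|_{\mathbb{T}}\le\frac1{CH_s}$ or $\ge\frac{C}{H_s}$, each have size $(1-o(1))(N_s-H_s+1)$; (iii) some $\mathbf{H}'$ with $1\prec\mathbf{H}'\prec\mathbf{H}$ has $\|f_{\mathrm{unf}}\|_{U^2(\mathbf{N},\mathbf{H}')}=0$. *)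

theory Defs
  imports "HOL-Analysis.Analysis"
begin

text \<open>
  The natural numbers of the mathematics start at 1. Functions on them are rendered as functions on
  \<^typ>\<open>nat\<close> of which only the values at positive arguments are ever used. A sequence
  \<open>N\<close> is likewise indexed by \<open>s \<ge> 1\<close>, with \<open>N 0 = 0\<close> by convention.
\<close>

definition circ_exp :: "real \<Rightarrow> complex" where
  "circ_exp x = exp (2 * of_real pi * \<i> * of_real x)"

definition dist_int :: "real \<Rightarrow> real" where
  "dist_int x = \<bar>x - of_int (round x)\<bar>"

definition avg :: "(nat \<Rightarrow> nat) \<Rightarrow> (nat \<Rightarrow> real) \<Rightarrow> nat \<Rightarrow> real" where
  "avg N a s = (\<Sum>n=1..N s. a n) / real (N s)"

text \<open>\<open>mean\<close>, \<open>norm2\<close> and \<open>U2_norm\<close> are given by \<^const>\<open>lim\<close> and are meaningful only if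
  the limit exists; existence is demanded explicitly wherever they are used.\<close>

definition mean :: "(nat \<Rightarrow> nat) \<Rightarrow> (nat \<Rightarrow> real) \<Rightarrow> real" where
  "mean N a = lim (avg N a)"

definition norm2 :: "(nat \<Rightarrow> nat) \<Rightarrow> (nat \<Rightarrow> complex) \<Rightarrow> real" where
  "norm2 N g = sqrt (mean N (\<lambda>n. (cmod (g n))\<^sup>2))"

text \<open>Functions on \<open>\<int>/M\<int>\<close> are read off at the residues \<open>0, \<dots>, M - 1\<close>.\<close>

definition U2_sum :: "nat \<Rightarrow> (nat \<Rightarrow> complex) \<Rightarrow> complex" where
  "U2_sum M u = (\<Sum>x<M. \<Sum>h\<^sub>1<M. \<Sum>h\<^sub>2<M.
     u x * cnj (u ((x + h\<^sub>1) mod M) * u ((x + h\<^sub>2) mod M)) * u ((x + h\<^sub>1 + h\<^sub>2) mod M))"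

definition U2_cyclic :: "nat \<Rightarrow> (nat \<Rightarrow> complex) \<Rightarrow> real" where
  "U2_cyclic M u = root 4 (Re (U2_sum M u) / real M ^ 3)"

definition U2_interval_mod :: "nat \<Rightarrow> nat \<Rightarrow> nat \<Rightarrow> (nat \<Rightarrow> complex) \<Rightarrow> real" where
  "U2_interval_mod M x L g =
     U2_cyclic M (\<lambda>n. indicator {1..L} n * g (x + n)) / U2_cyclic M (indicator {1..L})"

text \<open>The norm on \<open>{x+1, \<dots>, x+L}\<close>. Any modulus \<open>M \<ge> 4L\<close> gives the same value, see
  \<open>U2_interval_mod_eq\<close> below.\<close>

definition U2_interval :: "nat \<Rightarrow> nat \<Rightarrow> (nat \<Rightarrow> complex) \<Rightarrow> real" where
  "U2_interval x L g = U2_interval_mod (4 * L) x L g"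

text \<open>For \<open>n \<ge> 1\<close> the window \<open>{n, \<dots>, n+H-1}\<close> is \<open>{x+1, \<dots>, x+H}\<close> with \<open>x = n - 1\<close>. The truncated
  difference \<open>N + 1 - H\<close> is harmless, since \<open>H \<le> N\<close> for all large indices in all uses.\<close>

definition U2_avg :: "(nat \<Rightarrow> nat) \<Rightarrow> (nat \<Rightarrow> nat) \<Rightarrow> (nat \<Rightarrow> complex) \<Rightarrow> nat \<Rightarrow> real" where
  "U2_avg N H g s =
     (\<Sum>n=1..N s + 1 - H s. U2_interval (n - 1) (H s) g) / real (N s + 1 - H s)"

definition U2_norm :: "(nat \<Rightarrow> nat) \<Rightarrow> (nat \<Rightarrow> nat) \<Rightarrow> (nat \<Rightarrow> complex) \<Rightarrow> real" where
  "U2_norm N H g = lim (U2_avg N H g)"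

definition one_prec :: "(nat \<Rightarrow> nat) \<Rightarrow> bool" where
  "one_prec H \<longleftrightarrow> filterlim H at_top sequentially"

definition prec :: "(nat \<Rightarrow> nat) \<Rightarrow> (nat \<Rightarrow> nat) \<Rightarrow> bool" where
  "prec H N \<longleftrightarrow> (\<lambda>s. real (H s) / real (N s)) \<longlonglongrightarrow> 0"

text \<open>The sets \<open>{n \<in> [N\<^sub>s - H\<^sub>s + 1]. P s n}\<close> have size \<open>(1 - o(1)) (N\<^sub>s - H\<^sub>s + 1)\<close>.\<close>

definition almost_all_windows ::
    "(nat \<Rightarrow> nat) \<Rightarrow> (nat \<Rightarrow> nat) \<Rightarrow> (nat \<Rightarrow> nat \<Rightarrow> bool) \<Rightarrow> bool" where
  "almost_all_windows N H P \<longleftrightarrow>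
     (\<lambda>s. real (card {n \<in> {1..N s + 1 - H s}. P s n}) / real (N s + 1 - H s)) \<longlonglongrightarrow> 1"

definition U2_structured :: "(nat \<Rightarrow> nat) \<Rightarrow> (nat \<Rightarrow> nat) \<Rightarrow> (nat \<Rightarrow> real) \<Rightarrow> bool" where
  "U2_structured N H g \<longleftrightarrow>
     (\<forall>\<epsilon>>0. \<exists>(d::nat) (c :: nat \<Rightarrow> nat \<Rightarrow> complex) (\<alpha> :: nat \<Rightarrow> nat \<Rightarrow> real).
        d \<ge> 1 \<and>
        (\<forall>i\<in>{1..d}. \<forall>n\<ge>1. cmod (c i n) \<le> 1) \<and>
        convergent (avg N (\<lambda>n.
          (cmod ((\<Sum>i=1..d. c i n * circ_exp (real n * \<alpha> i n)) - complex_of_real (g n)))\<^sup>2)) \<and>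
        norm2 N (\<lambda>n. (\<Sum>i=1..d. c i n * circ_exp (real n * \<alpha> i n)) - complex_of_real (g n)) \<le> \<epsilon> \<and>
        (\<forall>C::real. C \<ge> 1 \<longrightarrow>
           almost_all_windows N H
             (\<lambda>s n. \<forall>i\<in>{1..d}. (\<lambda>h. \<alpha> i (n + h)) constant_on {1..H s}) \<and>
           almost_all_windows N H
             (\<lambda>s n. \<forall>i\<in>{1..d}. (\<lambda>h. c i (n + h)) constant_on {1..H s}) \<and>
           almost_all_windows N H
             (\<lambda>s n. \<forall>w :: nat \<Rightarrow> int. (\<forall>i\<in>{1..d}. \<bar>real_of_int (w i)\<bar> \<le> C) \<longrightarrow>
                dist_int (\<Sum>i=1..d. real_of_int (w i) * \<alpha> i n) \<le> 1 / (C * real (H s)) \<or>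
                dist_int (\<Sum>i=1..d. real_of_int (w i) * \<alpha> i n) \<ge> C / real (H s))))"

definition U2_good_decomposition ::
    "(nat \<Rightarrow> nat) \<Rightarrow> (nat \<Rightarrow> nat) \<Rightarrow> (nat \<Rightarrow> real) \<Rightarrow> (nat \<Rightarrow> real) \<Rightarrow> (nat \<Rightarrow> real) \<Rightarrow> bool" where
  "U2_good_decomposition N H f f_str f_unf \<longleftrightarrow>
     (\<forall>n\<ge>1. f n = f_str n + f_unf n) \<and>
     (\<forall>n\<ge>1. f_str n \<in> {0..1}) \<and>
     convergent (avg N f_unf) \<and> mean N f_unf = 0 \<and>
     U2_structured N H f_str \<and>
     (\<exists>H'. (\<forall>s\<ge>1. H' s \<ge> 1) \<and> one_prec H' \<and> prec H' H \<and>
        convergent (U2_avg N H' (\<lambda>n. complex_of_real (f_unf n))) \<and>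
        U2_norm N H' (\<lambda>n. complex_of_real (f_unf n)) = 0)"

definition U2_good_scale :: "(nat \<Rightarrow> nat) \<Rightarrow> (nat \<Rightarrow> nat) \<Rightarrow> (nat \<Rightarrow> real) \<Rightarrow> bool" where
  "U2_good_scale N H f \<longleftrightarrow> (\<exists>f_str f_unf. U2_good_decomposition N H f f_str f_unf)"

text \<open>The side condition \<open>m \<ge> 1\<close> matters: \<open>0\<close> divides no positive number.\<close>

definition least_nondivisor :: "nat \<Rightarrow> nat" where
  "least_nondivisor q = (LEAST m. m \<ge> 1 \<and> \<not> m dvd q)"


subsection \<open>Sanity checks for the Gowers norm\<close>

lemma sum_shift_mod:
  fixes F :: "nat \<Rightarrow> 'a::comm_monoid_add"
  assumes "M > 0"
  shows "(\<Sum>h<M. F ((x + h) mod M)) = (\<Sum>y<M. F y)"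
proof (rule sum.reindex_bij_betw)
  have inj: "inj_on (\<lambda>h. (x + h) mod M) {..<M}"
  proof (rule inj_onI)
    fix a b assume ab: "a \<in> {..<M}" "b \<in> {..<M}" and eq: "(x + a) mod M = (x + b) mod M"
    have "int M dvd int (x + a) - int (x + b)"
      using eq by (metis mod_eq_dvd_iff of_nat_mod)
    then have "int a mod int M = int b mod int M" by (simp add: mod_eq_dvd_iff)
    then show "a = b" using ab by simp
  qed
  moreover have "(\<lambda>h. (x + h) mod M) ` {..<M} = {..<M}"
    by (rule endo_inj_surj) (use assms inj in auto)
  ultimately show "bij_betw (\<lambda>h. (x + h) mod M) {..<M} {..<M}"
    by (simp add: bij_betw_def)
qed

lemma U2_sum_eq:
  "U2_sum M u =
     of_real (\<Sum>h<M. (cmod (\<Sum>x<M. u x * cnj (u ((x + h) mod M))))\<^sup>2)"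
proof (cases "M = 0")
  case False
  have *: "(\<Sum>h\<^sub>2<M. u x * cnj (u ((x + h) mod M) * u ((x + h\<^sub>2) mod M)) * u ((x + h + h\<^sub>2) mod M))
      = u x * cnj (u ((x + h) mod M)) * (\<Sum>y<M. cnj (u y) * u ((y + h) mod M))" for x h
  proof -
    have "(\<Sum>y<M. cnj (u y) * u ((y + h) mod M))
        = (\<Sum>k<M. cnj (u ((x + k) mod M)) * u (((x + k) mod M + h) mod M))"
      by (rule sum_shift_mod[symmetric]) (use False in simp)
    also have "\<dots> = (\<Sum>k<M. cnj (u ((x + k) mod M)) * u ((x + h + k) mod M))"
    proof (intro sum.cong refl)
      fix k
      have "((x + k) mod M + h) mod M = (x + h + k) mod M"
        by (simp only: mod_add_left_eq) (simp add: ac_simps)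
      then show "cnj (u ((x + k) mod M)) * u (((x + k) mod M + h) mod M)
          = cnj (u ((x + k) mod M)) * u ((x + h + k) mod M)" by simp
    qed
    finally show ?thesis by (simp add: sum_distrib_left mult_ac)
  qed
  have "U2_sum M u = (\<Sum>x<M. \<Sum>h<M. u x * cnj (u ((x + h) mod M))
           * (\<Sum>y<M. cnj (u y) * u ((y + h) mod M)))"
    unfolding U2_sum_def * ..
  also have "\<dots> = (\<Sum>h<M. \<Sum>x<M. u x * cnj (u ((x + h) mod M))
           * (\<Sum>y<M. cnj (u y) * u ((y + h) mod M)))"
    by (rule sum.swap)
  also have "\<dots> = (\<Sum>h<M. (\<Sum>x<M. u x * cnj (u ((x + h) mod M)))
           * cnj (\<Sum>x<M. u x * cnj (u ((x + h) mod M))))"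
    by (simp add: sum_distrib_right)
  finally show ?thesis by (simp only: of_real_sum complex_norm_square)
qed (simp add: U2_sum_def)

text \<open>Hence taking the real part in \<open>U2_cyclic\<close> discards nothing.\<close>

lemma U2_cyclic_power4:
  assumes "M > 0"
  shows "complex_of_real (U2_cyclic M u ^ 4) = U2_sum M u / of_nat M ^ 3"
proof -
  have "0 \<le> Re (U2_sum M u)" by (simp add: U2_sum_eq sum_nonneg del: of_real_sum)
  then have "U2_cyclic M u ^ 4 = Re (U2_sum M u) / real M ^ 3"
    unfolding U2_cyclic_def by (intro real_root_pow_pos2) auto
  then show ?thesis by (simp add: U2_sum_eq)
qed

lemma U2_sum_supported:
  assumes M: "M \<ge> 4 * L" and L: "L > 0" and supp: "\<And>n. n \<notin> {1..L} \<Longrightarrow> u n = 0"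
  shows "U2_sum M u = (\<Sum>x=1..L. \<Sum>a=1..L. \<Sum>b=1..L.
           u x * cnj (u a * u b) * (if x \<le> a + b then u (a + b - x) else 0))"
proof -
  have M0: "M > 0" using M L by simp
  define D where "D x a b = u ((a + b + (M - x)) mod M)" for x a b
  have "U2_sum M u = (\<Sum>x<M. \<Sum>a<M. \<Sum>b<M. u x * cnj (u a * u b) * D x a b)"
    unfolding U2_sum_def
  proof (rule sum.cong[OF refl])
    fix x assume x: "x \<in> {..<M}"
    have D: "D x ((x + h) mod M) ((x + k) mod M) = u ((x + h + k) mod M)" for h k
    proof -
      have "((x + h) mod M + (x + k) mod M + (M - x)) mod M = ((x + h) + (x + k) + (M - x)) mod M"
        by (metis mod_add_eq mod_add_left_eq)
      also have "(x + h) + (x + k) + (M - x) = (x + h + k) + M" using x by simp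
      finally show ?thesis by (simp add: D_def)
    qed
    have "(\<Sum>a<M. \<Sum>b<M. u x * cnj (u a * u b) * D x a b)
       = (\<Sum>h<M. \<Sum>b<M. u x * cnj (u ((x + h) mod M) * u b) * D x ((x + h) mod M) b)"
      by (rule sum_shift_mod[OF M0, symmetric])
    also have "\<dots> = (\<Sum>h<M. \<Sum>k<M. u x * cnj (u ((x + h) mod M) * u ((x + k) mod M))
         * D x ((x + h) mod M) ((x + k) mod M))"
      by (intro sum.cong refl sum_shift_mod[OF M0, symmetric])
    finally show "(\<Sum>h<M. \<Sum>k<M. u x * cnj (u ((x + h) mod M) * u ((x + k) mod M))
        * u ((x + h + k) mod M)) = (\<Sum>a<M. \<Sum>b<M. u x * cnj (u a * u b) * D x a b)"
      by (simp add: D)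
  qed
  also have "\<dots> = (\<Sum>x=1..L. \<Sum>a<M. \<Sum>b<M. u x * cnj (u a * u b) * D x a b)"
    by (rule sum.mono_neutral_right) (use M L supp in auto)
  also have "\<dots> = (\<Sum>x=1..L. \<Sum>a=1..L. \<Sum>b<M. u x * cnj (u a * u b) * D x a b)"
    by (intro sum.cong refl sum.mono_neutral_right) (use M L supp in auto)
  also have "\<dots> = (\<Sum>x=1..L. \<Sum>a=1..L. \<Sum>b=1..L. u x * cnj (u a * u b) * D x a b)"
    by (intro sum.cong refl sum.mono_neutral_right) (use M L supp in auto)
  also have "\<dots> = (\<Sum>x=1..L. \<Sum>a=1..L. \<Sum>b=1..L.
           u x * cnj (u a * u b) * (if x \<le> a + b then u (a + b - x) else 0))"
  proof (intro sum.cong refl)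
    fix x a b assume xab: "x \<in> {1..L}" "a \<in> {1..L}" "b \<in> {1..L}"
    have "D x a b = (if x \<le> a + b then u (a + b - x) else 0)"
    proof (cases "x \<le> a + b")
      case True
      then have "a + b + (M - x) = (a + b - x) + M" "a + b - x < M" using xab M by auto
      then have "(a + b + (M - x)) mod M = a + b - x" by (simp only: mod_add_self2 mod_less)
      then show ?thesis using True by (simp add: D_def)
    next
      case False
      then have "a + b + (M - x) < M" "a + b + (M - x) > L" using xab M by auto
      then show ?thesis using False by (simp add: D_def supp)
    qed
    then show "u x * cnj (u a * u b) * D x a b =
        u x * cnj (u a * u b) * (if x \<le> a + b then u (a + b - x) else 0)" by simp
  qed
  finally show ?thesis .
qed

lemma U2_interval_mod_eq:
  assumes "M \<ge> 4 * L" "L > 0"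
  shows "U2_interval_mod M x L g = U2_interval x L g"
proof -
  have eq: "U2_sum M u = U2_sum (4 * L) u" if "\<And>n. n \<notin> {1..L} \<Longrightarrow> u n = 0" for u
    using U2_sum_supported[OF assms that] U2_sum_supported[OF order_refl assms(2) that] by simp
  have "U2_sum M (\<lambda>n. indicator {1..L} n * g (x + n))
      = U2_sum (4 * L) (\<lambda>n. indicator {1..L} n * g (x + n))"
    "U2_sum M (indicator {1..L}) = U2_sum (4 * L) (indicator {1..L})"
    by (rule eq; simp)+
  moreover have "M > 0" using assms by simp
  ultimately show ?thesis using assms(2)
    unfolding U2_interval_def U2_interval_mod_def U2_cyclic_def
    by (simp add: real_root_divide)
qed

end

theory Submission
  imports Defs "HOL-Real_Asymp.Real_Asymp"
begin

text \<open>
  On almost every window \<open>f_str\<close> is close in mean to \<open>\<Sum>i\<le>d. c i * e (n \<alpha> i)\<close> with constant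
  \<open>c i\<close> and \<open>\<alpha> i\<close>, so any \<open>Q\<close> for which all \<open>Q \<alpha> i\<close> are nearly integers is an almost period.
  Such a \<open>Q\<close> exists among the multiples of \<open>D = j!\<close> in \<open>[H, (1+\<delta>)H]\<close>: the sum over these multiples
  of the nonnegative trigonometric polynomial \<open>\<Prod>i\<le>d. \<bar>(1 + e (Q \<alpha> i)) / 2\<bar> ^ (2R)\<close>, which is
  concentrated near \<open>0\<close>, expands into geometric sums with frequencies \<open>w \<cdot> \<alpha>\<close>. By the dichotomy in the
  definition of a good scale, each \<open>w \<cdot> \<alpha>\<close> is either so close to an integer that its sum has
  nonnegative real part, or so far from it that its sum is negligible; hence the constant term, which
  is at least \<open>(R+1) ^ (-d)\<close>, survives and exceeds the exponentially small values of the polynomial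
  away from \<open>0\<close>. A diagonal choice of \<open>j\<close> as a function of \<open>s\<close> concludes.
\<close>

subsection \<open>Exponential sums\<close>

lemma circ_exp_conv_cis: "circ_exp x = cis (2 * pi * x)"
  by (simp add: circ_exp_def cis_conv_exp mult_ac)

lemma circ_exp_add: "circ_exp (x + y) = circ_exp x * circ_exp y"
  by (simp add: circ_exp_conv_cis cis_mult ring_distribs)

lemma circ_exp_0 [simp]: "circ_exp 0 = 1"
  by (simp add: circ_exp_conv_cis)

lemma norm_circ_exp [simp]: "cmod (circ_exp x) = 1"
  by (simp add: circ_exp_conv_cis)

lemma circ_exp_of_int [simp]: "circ_exp (of_int k) = 1"
  using cis_multiple_2pi[of "of_int k"] by (simp add: circ_exp_conv_cis)

lemma cnj_circ_exp: "cnj (circ_exp x) = circ_exp (- x)"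
  by (simp add: circ_exp_conv_cis cis_cnj)

lemma circ_exp_sum: "circ_exp (\<Sum>i\<in>A. x i) = (\<Prod>i\<in>A. circ_exp (x i))"
  by (induction A rule: infinite_finite_induct) (auto simp: circ_exp_add)

lemma circ_exp_of_nat_mult: "circ_exp (real k * x) = circ_exp x ^ k"
  by (induction k) (auto simp: circ_exp_add ring_distribs)

lemma circ_exp_of_nat_mult_round:
  "circ_exp (real q * x) = circ_exp (real q * (x - of_int (round x)))"
proof -
  have "real q * x = real q * (x - of_int (round x)) + of_int (int q * round x)"
    by (simp add: algebra_simps)
  then show ?thesis by (metis circ_exp_add circ_exp_of_int mult.right_neutral)
qed

text \<open>The mean value theorem gives sin (y/2) \<ge> (y/2) cos (y/2), and doubling the angle
  turns this into sin y \<ge> y cos^2 (y/2) = y (1 + cos y) / 2, where cos y \<ge> 0.\<close>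

lemma half_le_sin:
  fixes y :: real
  assumes "0 \<le> y" "y \<le> pi / 2"
  shows "y / 2 \<le> sin y"
proof (cases "y = 0")
  case False
  then obtain \<xi> where \<xi>: "0 < \<xi>" "\<xi> < y / 2" "sin (y / 2) = y / 2 * cos \<xi>"
    using MVT2[of 0 "y / 2" sin cos] assms by auto
  have c: "cos (y / 2) \<le> cos \<xi>" "0 \<le> cos (y / 2)"
    using \<xi> assms by (auto intro!: cos_monotone_0_pi_le cos_ge_zero)
  have "y / 2 \<le> y * (cos (y / 2))\<^sup>2"
    using cos_double_cos[of "y / 2"] cos_ge_zero[of y] assms
    by (auto intro!: mult_left_mono[of "1/2" _ y, simplified])
  also have "\<dots> = 2 * (y / 2 * cos (y / 2)) * cos (y / 2)"
    by (simp add: power2_eq_square)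
  also have "\<dots> \<le> 2 * sin (y / 2) * cos (y / 2)"
    using mult_left_mono[OF c(1), of "y / 2"] c(2) assms \<xi>(3) by (intro mult_right_mono) auto
  also have "\<dots> = sin y" using sin_double[of "y / 2"] by simp
  finally show ?thesis .
qed simp

text \<open>With \<open>r\<close> the signed distance from \<open>x\<close> to the nearest integer,
  the chord on the right has length 2 sin (pi |r|), which is at least pi |r| by
  \<open>half_le_sin\<close>. The lost constant is harmless, as \<open>C\<close> can be taken large
  later.\<close>

lemma dist_int_le_norm_circ_exp: "dist_int x \<le> cmod (1 - circ_exp x)"
proof -
  define r where "r = x - of_int (round x)"
  have r: "\<bar>r\<bar> \<le> 1/2" unfolding r_def
    using of_int_round_abs_le[of x] by (simp add: abs_minus_commute)
  have "circ_exp x = circ_exp r"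
    using circ_exp_of_nat_mult_round[of 1 x] by (simp add: r_def)
  then have "(cmod (1 - circ_exp x))\<^sup>2 = (1 - cos (2*pi*r))\<^sup>2 + (sin (2*pi*r))\<^sup>2"
    by (simp add: cmod_power2 circ_exp_conv_cis)
  also have "\<dots> = 2 - 2 * cos (2 * pi * r)"
    using sin_cos_squared_add[of "2*pi*r"] by (simp add: power2_eq_square algebra_simps)
  also have "cos (2 * pi * r) = 1 - 2 * (sin (pi * \<bar>r\<bar>))\<^sup>2"
    using cos_double_sin[of "pi * r"] by (cases "r \<ge> 0") (auto simp: mult.assoc)
  finally have eq: "(cmod (1 - circ_exp x))\<^sup>2 = (2 * sin (pi * \<bar>r\<bar>))\<^sup>2"
    by (simp add: power2_eq_square)
  have y: "pi * \<bar>r\<bar> / 2 \<le> sin (pi * \<bar>r\<bar>)"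
    using r by (intro half_le_sin) auto
  have "1 * \<bar>r\<bar> \<le> pi * \<bar>r\<bar>"
    using pi_ge_two by (intro mult_right_mono) auto
  also have "\<dots> \<le> 2 * sin (pi * \<bar>r\<bar>)" using y by simp
  also have "\<dots> \<le> cmod (1 - circ_exp x)"
    by (rule power2_le_imp_le[OF eq_refl[OF eq[symmetric]]]) simp
  finally show ?thesis by (simp add: dist_int_def r_def)
qed

text \<open>Multiplying by \<open>1 - circ_exp x\<close> telescopes the sum to a difference of two
  unit vectors. The product form also covers integral \<open>x\<close>, where a quotient would
  divide by zero.\<close>

lemma norm_circ_exp_geometric_sum:
  assumes "a \<le> b"
  shows "cmod (\<Sum>q=a..<b. circ_exp (real q * x)) * dist_int x \<le> 2"
proof -
  let ?S = "\<Sum>q=a..<b. circ_exp (real q * x)"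
  have "?S * (1 - circ_exp x) = (\<Sum>q=a..<b. circ_exp (real q * x) - circ_exp (real (Suc q) * x))"
    by (simp add: sum_distrib_right sum_distrib_left algebra_simps circ_exp_add flip: sum_subtractf)
  also have "\<dots> = circ_exp (real a * x) - circ_exp (real b * x)"
    using sum_Suc_diff'[OF assms, of "\<lambda>q. - circ_exp (real q * x)"] by simp
  finally have "cmod ?S * cmod (1 - circ_exp x) = cmod (circ_exp (real a * x) - circ_exp (real b * x))"
    by (metis norm_mult)
  also have "\<dots> \<le> 2"
    using norm_triangle_ineq4[of "circ_exp (real a * x)" "circ_exp (real b * x)"] by simp
  finally show ?thesis
    using mult_left_mono[OF dist_int_le_norm_circ_exp[of x], of "cmod ?S"] by simp
qed

text \<open>The phase \<open>real q * x\<close> is within a quarter turn of an integer, so its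
  exponential stays in the closed right half-plane.\<close>

lemma Re_circ_exp_nonneg:
  assumes "real q * dist_int x \<le> 1 / 4"
  shows "0 \<le> Re (circ_exp (real q * x))"
proof -
  define t where "t = real q * (x - of_int (round x))"
  have "\<bar>t\<bar> \<le> 1 / 4" using assms by (simp add: t_def dist_int_def abs_mult)
  then have "\<bar>2 * pi * t\<bar> \<le> pi / 2"
    using mult_left_mono[of "\<bar>t\<bar>" "1/4" "2 * pi"] by (simp add: abs_mult)
  then have "0 \<le> cos (2 * pi * t)" by (intro cos_ge_zero) linarith+
  then show ?thesis
    by (subst circ_exp_of_nat_mult_round) (simp add: circ_exp_conv_cis t_def)
qed

subsection \<open>A trigonometric polynomial concentrated at the origin\<close>

definition bump_freqs :: "nat \<Rightarrow> nat \<Rightarrow> (nat \<Rightarrow> nat) set" where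
  "bump_freqs d R = PiE {1..d} (\<lambda>_. {..R})"

text \<open>A product of binomial distributions with parameter 1/2; these are the Fourier
  coefficients of \<open>bump\<close>.\<close>

definition bump_weight :: "nat \<Rightarrow> nat \<Rightarrow> (nat \<Rightarrow> nat) \<Rightarrow> real" where
  "bump_weight d R k = (\<Prod>i=1..d. real (R choose k i) / 2 ^ R)"

text \<open>A square root of the kernel really used: its squared modulus is the product of cos^(2R)
  (pi x_i), whose Fourier coefficients are correlations of the nonnegative
  \<open>bump_weight\<close>.\<close>

definition bump :: "nat \<Rightarrow> nat \<Rightarrow> (nat \<Rightarrow> real) \<Rightarrow> complex" where
  "bump d R x = (\<Prod>i=1..d. ((1 + circ_exp (x i)) / 2) ^ R)"

lemma finite_bump_freqs [simp]: "finite (bump_freqs d R)"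
  by (simp add: bump_freqs_def finite_PiE)

lemma card_bump_freqs: "card (bump_freqs d R) = (R + 1) ^ d"
  by (simp add: bump_freqs_def card_PiE)

lemma bump_weight_nonneg: "0 \<le> bump_weight d R k"
  by (simp add: bump_weight_def prod_nonneg)

lemma bump_eq_sum:
  "bump d R x = (\<Sum>k\<in>bump_freqs d R. of_real (bump_weight d R k) * circ_exp (\<Sum>i=1..d. real (k i) * x i))"
proof -
  have "((1 + circ_exp (x i)) / 2) ^ R
      = (\<Sum>k\<le>R. of_real (real (R choose k) / 2 ^ R) * circ_exp (real k * x i))" for i
  proof -
    have "(circ_exp (x i) + 1) ^ R = (\<Sum>k\<le>R. of_nat (R choose k) * circ_exp (x i) ^ k)"
      by (subst binomial_ring) simp
    then show ?thesis
      by (simp add: power_divide add.commute sum_divide_distrib circ_exp_of_nat_mult)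
  qed
  then have "bump d R x
      = (\<Prod>i=1..d. \<Sum>k\<le>R. of_real (real (R choose k) / 2 ^ R) * circ_exp (real k * x i))"
    by (simp add: bump_def)
  also have "\<dots> = (\<Sum>k\<in>bump_freqs d R.
      \<Prod>i=1..d. of_real (real (R choose k i) / 2 ^ R) * circ_exp (real (k i) * x i))"
    unfolding bump_freqs_def by (rule prod_sum_PiE) auto
  also have "\<dots> = (\<Sum>k\<in>bump_freqs d R.
      of_real (bump_weight d R k) * circ_exp (\<Sum>i=1..d. real (k i) * x i))"
    by (simp only: bump_weight_def circ_exp_sum prod.distrib of_real_prod)
  finally show ?thesis .
qed

lemma sum_bump_weight: "(\<Sum>k\<in>bump_freqs d R. bump_weight d R k) = 1"
proof -
  have "bump d R (\<lambda>_. 0) = 1" by (simp add: bump_def)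
  then have "complex_of_real (\<Sum>k\<in>bump_freqs d R. bump_weight d R k) = of_real 1"
    by (simp add: bump_eq_sum)
  then show ?thesis by (simp only: of_real_eq_iff)
qed

text \<open>Cauchy-Schwarz for a probability distribution on \<open>(R + 1) ^ d\<close> points. The
  sum is the diagonal \<open>k = l\<close> of \<open>norm_bump_squared\<close>; it decays only
  polynomially in \<open>R\<close>, while \<open>norm_bump_squared_le\<close> decays
  exponentially.\<close>

lemma sum_bump_weight_squared: "1 / real (R + 1) ^ d \<le> (\<Sum>k\<in>bump_freqs d R. (bump_weight d R k)\<^sup>2)"
proof -
  have "1 \<le> (\<Sum>k\<in>bump_freqs d R. (bump_weight d R k)\<^sup>2) * real (R + 1) ^ d"
    using sum_squared_le_sum_of_squares[of "bump_weight d R" "bump_freqs d R"]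
    by (simp add: sum_bump_weight card_bump_freqs)
  then show ?thesis by (simp add: divide_le_eq add_pos_nonneg)
qed

lemma norm_bump_squared:
  "(cmod (bump d R x))\<^sup>2 = (\<Sum>k\<in>bump_freqs d R. \<Sum>l\<in>bump_freqs d R.
     bump_weight d R k * bump_weight d R l *
     Re (circ_exp (\<Sum>i=1..d. (real (k i) - real (l i)) * x i)))"
proof -
  let ?e = "\<lambda>k. circ_exp (\<Sum>i=1..d. real (k i) * x i)" and ?p = "bump_weight d R"
  have e: "?e k * cnj (?e l) = circ_exp (\<Sum>i=1..d. (real (k i) - real (l i)) * x i)" for k l
    by (simp add: cnj_circ_exp left_diff_distrib sum_subtractf flip: circ_exp_add)
  have Re_of_real_mult: "Re (of_real r * z) = r * Re z" for r z by simp
  have "(cmod (bump d R x))\<^sup>2 = Re (bump d R x * cnj (bump d R x))"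
    by (simp only: complex_norm_square[symmetric] Re_complex_of_real)
  also have "bump d R x * cnj (bump d R x) = (\<Sum>k\<in>bump_freqs d R. \<Sum>l\<in>bump_freqs d R.
      of_real (?p k * ?p l) * (?e k * cnj (?e l)))"
    by (simp add: bump_eq_sum sum_product mult_ac)
  finally show ?thesis by (simp only: e Re_sum Re_of_real_mult)
qed

text \<open>For |z| = 1 the parallelogram law gives |1 + z|^2 = 4 - |z - 1|^2. One coordinate far
  from the integers thus makes its factor small, and all the other factors are at most 1.\<close>

lemma norm_bump_squared_le:
  assumes "i \<in> {1..d}" "\<delta> \<le> cmod (circ_exp (x i) - 1)" "0 \<le> \<delta>"
  shows "(cmod (bump d R x))\<^sup>2 \<le> (1 - \<delta>\<^sup>2 / 4) ^ R"
proof -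
  have par: "(cmod ((1 + circ_exp y) / 2))\<^sup>2 = 1 - (cmod (circ_exp y - 1))\<^sup>2 / 4" for y
  proof -
    have "(cmod ((1 + circ_exp y) / 2))\<^sup>2 = (cmod (1 + circ_exp y))\<^sup>2 / 4"
      by (simp add: norm_divide power_divide)
    also have "(cmod (1 + circ_exp y))\<^sup>2 = 4 - (cmod (circ_exp y - 1))\<^sup>2"
    proof -
      have "(cmod (circ_exp y))\<^sup>2 = 1" by simp
      then show ?thesis unfolding cmod_power2 by (simp add: power2_eq_square algebra_simps)
    qed
    finally show ?thesis by simp
  qed
  define g where "g j = cmod ((1 + circ_exp (x j)) / 2)" for j
  have g: "(g j ^ R)\<^sup>2 = ((g j)\<^sup>2) ^ R" for j by (metis power_mult mult.commute)
  have "cmod (bump d R x) = (\<Prod>j=1..d. g j ^ R)"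
    unfolding bump_def g_def prod_norm[symmetric] norm_power ..
  then have "(cmod (bump d R x))\<^sup>2 = (\<Prod>j=1..d. ((g j)\<^sup>2) ^ R)"
    by (simp only: prod_power_distrib g)
  also have "\<dots> = ((g i)\<^sup>2) ^ R * (\<Prod>j\<in>{1..d} - {i}. ((g j)\<^sup>2) ^ R)"
    using assms by (intro prod.remove) auto
  also have "\<dots> \<le> ((g i)\<^sup>2) ^ R * 1"
  proof (intro mult_left_mono prod_le_1 conjI)
    show "((g j)\<^sup>2) ^ R \<le> 1" for j
    proof (rule power_le_one)
      show "(g j)\<^sup>2 \<le> 1" unfolding g_def par by simp
    qed simp
  qed auto
  also have "((g i)\<^sup>2) ^ R \<le> (1 - \<delta>\<^sup>2 / 4) ^ R"
  proof (rule power_mono)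
    have "\<delta>\<^sup>2 \<le> (cmod (circ_exp (x i) - 1))\<^sup>2" using assms by (intro power_mono)
    then show "(g i)\<^sup>2 \<le> 1 - \<delta>\<^sup>2 / 4" unfolding g_def par by simp
  qed simp
  finally show ?thesis by simp
qed

subsection \<open>Simultaneous return times\<close>

text \<open>The last clause of \<open>U2_structured\<close> at a single point, freed from
  \<open>n\<close> and \<open>s\<close> so that return times can be found uniformly in the frequency
  vector.\<close>

definition dichotomy :: "nat \<Rightarrow> real \<Rightarrow> nat \<Rightarrow> (nat \<Rightarrow> real) \<Rightarrow> bool" where
  "dichotomy d C H \<alpha> \<longleftrightarrow> (\<forall>w :: nat \<Rightarrow> int. (\<forall>i\<in>{1..d}. \<bar>real_of_int (w i)\<bar> \<le> C) \<longrightarrow>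
     dist_int (\<Sum>i=1..d. real_of_int (w i) * \<alpha> i) \<le> 1 / (C * real H) \<or>
     dist_int (\<Sum>i=1..d. real_of_int (w i) * \<alpha> i) \<ge> C / real H)"

lemma power_beats_polynomial:
  fixes \<rho> c :: real
  assumes "0 < \<rho>" "\<rho> < 1"
  shows "\<exists>R::nat. c * real (R + 1) ^ d * \<rho> ^ R < 1"
proof -
  have "(\<lambda>R. c * (real R + 1) ^ d * \<rho> ^ R) \<longlonglongrightarrow> 0"
    using assms by real_asymp
  then have "eventually (\<lambda>R. c * (real R + 1) ^ d * \<rho> ^ R < 1) sequentially"
    by (rule order_tendstoD) simp
  then show ?thesis by (auto simp: eventually_sequentially add.commute)
qed

text \<open>\<open>C\<close> and \<open>H\<^sub>0\<close> must not depend on \<alpha>, since every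
  window brings its own frequencies. If no \<open>Q\<close> worked, the squared bump would be at
  most \<open>\<rho> ^ R\<close> at every candidate, contradicting the lower bound for its
  sum.\<close>

lemma bohr_return_time:
  fixes d D :: nat and \<delta> :: real
  assumes D: "D \<ge> 1" and \<delta>: "0 < \<delta>" "\<delta> \<le> 1"
  shows "\<exists>C\<ge>1. \<exists>H\<^sub>0. \<forall>H\<ge>H\<^sub>0. \<forall>\<alpha>. dichotomy d C H \<alpha> \<longrightarrow>
    (\<exists>Q. H \<le> Q \<and> real Q \<le> (1 + \<delta>) * real H \<and> D dvd Q \<and>
       (\<forall>i\<in>{1..d}. cmod (circ_exp (real Q * \<alpha> i) - 1) \<le> \<delta>))"
proof -
  define \<rho> where "\<rho> = 1 - \<delta>\<^sup>2 / 4"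
  have "\<delta>\<^sup>2 \<le> 1" using \<delta> by (simp add: power_le_one)
  then have "0 < \<rho>" "\<rho> < 1" using \<delta> unfolding \<rho>_def by auto
  then obtain R where "2 * real (R + 1) ^ d * \<rho> ^ R < 1"
    using power_beats_polynomial by blast
  define V where "V = real (R + 1) ^ d"
  have V: "V \<ge> 1" unfolding V_def by (rule one_le_power) simp
  have R: "\<rho> ^ R < 1 / (2 * V)"
    using \<open>2 * real (R + 1) ^ d * \<rho> ^ R < 1\<close> V unfolding V_def[symmetric]
    by (simp add: field_simps)
  \<comment> \<open>The second summand admits all the integer vectors \<open>D * (k - l)\<close> in
    the dichotomy; the first makes the total off-diagonal error at most half of the diagonal
    term.\<close>
  define C where "C = 8 * real D * V / \<delta> + real D * real R"
  have "8 * 1 * 1 / 1 \<le> 8 * real D * V / \<delta>"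
    using D V \<delta> by (intro frac_le mult_mono) auto
  then have C8: "C \<ge> 8" unfolding C_def by (simp add: add_increasing2)
  have CV: "C \<ge> 8 * real D * V / \<delta>" unfolding C_def by simp
  have CR: "C \<ge> real D * real R" unfolding C_def using D V \<delta> by simp
  \<comment> \<open>This forces \<open>\<delta> * H / D \<ge> 2\<close>, so rounding the endpoints
    below costs at most half of the interval.\<close>
  define H\<^sub>0 where "H\<^sub>0 = nat \<lceil>2 * real D / \<delta>\<rceil>"
  have main: "\<exists>Q. H \<le> Q \<and> real Q \<le> (1 + \<delta>) * real H \<and> D dvd Q \<and>
       (\<forall>i\<in>{1..d}. cmod (circ_exp (real Q * \<alpha> i) - 1) \<le> \<delta>)"
    if H: "H \<ge> H\<^sub>0" and dich: "dichotomy d C H \<alpha>" for H \<alpha>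
  proof (rule ccontr)
    assume neg: "\<not> ?thesis"
    have H2: "real H \<ge> 2 * real D / \<delta>" using H unfolding H\<^sub>0_def by linarith
    moreover have "2 * real D / \<delta> > 0" using D \<delta> by simp
    ultimately have H0: "real H > 0" by linarith
    \<comment> \<open>The \<open>q\<close> in \<open>{a..<b}\<close> are those with
      \<open>q * D\<close> between \<open>H\<close> and \<open>(1 + \<delta>) * H\<close>; the
      \<open>+ 1\<close> in \<open>b\<close> compensates for the half-open interval.\<close>
    define a where "a = nat \<lceil>real H / real D\<rceil>"
    define b where "b = nat \<lfloor>(1 + \<delta>) * real H / real D\<rfloor> + 1"
    have a: "real H / real D \<le> real a" "real a < real H / real D + 1"
      unfolding a_def using H0 by (auto simp: of_nat_nat ceiling_less_iff) linarith+
    have b: "(1 + \<delta>) * real H / real D < real b" "real b \<le> (1 + \<delta>) * real H / real D + 1"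
      unfolding b_def using H0 \<delta> by (auto simp: of_nat_nat) linarith
    have HD: "\<delta> * real H / real D \<ge> 2"
      using H2 D \<delta> by (simp add: field_simps)
    define L where "L = real b - real a"
    have L: "L \<ge> \<delta> * real H / (2 * real D)"
    proof -
      have "(1 + \<delta>) * real H / real D = real H / real D + \<delta> * real H / real D"
        by (simp add: add_divide_distrib distrib_right)
      moreover have "\<delta> * real H / (2 * real D) = (\<delta> * real H / real D) / 2" by simp
      ultimately show ?thesis using a b HD unfolding L_def by linarith
    qed
    have "\<delta> * real H / (2 * real D) > 0" using H0 \<delta> D by simp
    then have L0: "L > 0" using L by linarith
    then have ab: "a \<le> b" unfolding L_def by simp
    have q: "H \<le> q * D" "real (q * D) \<le> (1 + \<delta>) * real H" if "q \<in> {a..<b}" for q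
    proof -
      have "real H / real D \<le> real q" using that a by (meson atLeastLessThan_iff le_trans of_nat_mono order_trans)
      then have "real H \<le> real (q * D)" using D by (simp add: field_simps)
      then show "H \<le> q * D" by linarith
      have "real q \<le> real b - 1" using that by auto
      then have "real q \<le> (1 + \<delta>) * real H / real D" using b by linarith
      then show "real (q * D) \<le> (1 + \<delta>) * real H" using D by (simp add: field_simps)
    qed
    let ?x = "\<lambda>q i. real q * (real D * \<alpha> i)" and ?p = "bump_weight d R" and ?K = "bump_freqs d R"
    \<comment> \<open>By the contradiction hypothesis the multiple \<open>q * D\<close> must fail at
      some coordinate.\<close>
    have upper: "(cmod (bump d R (?x q)))\<^sup>2 \<le> \<rho> ^ R" if qab: "q \<in> {a..<b}" for q
    proof -
      obtain i where "i \<in> {1..d}" "\<delta> < cmod (circ_exp (real (q * D) * \<alpha> i) - 1)"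
        using neg q[OF qab] by (meson dvd_triv_right linorder_not_le)
      then show ?thesis unfolding \<rho>_def using \<delta>
        by (intro norm_bump_squared_le[of i]) (auto simp: mult.assoc)
    qed
    define \<theta> where "\<theta> k l = (\<Sum>i=1..d. real_of_int (int D * (int (k i) - int (l i))) * \<alpha> i)"
      for k l :: "nat \<Rightarrow> nat"
    define T where "T k l = (\<Sum>q=a..<b. Re (circ_exp (real q * \<theta> k l)))" for k l
    \<comment> \<open>On the diagonal \<theta> vanishes and all \<open>b - a\<close> terms equal 1.
      Off it, both alternatives of the dichotomy give the same lower bound, and only a lower bound
      is needed because the weights are nonnegative.\<close>
    have T: "(if k = l then L else 0) - 2 * real H / C \<le> T k l" if kl: "k \<in> ?K" "l \<in> ?K" for k l
    proof (cases "k = l")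
      case True
      then have "T k l = L" using ab by (simp add: T_def \<theta>_def L_def of_nat_diff)
      then show ?thesis using True C8 by simp
    next
      case False
      have "dist_int (\<theta> k l) \<le> 1 / (C * real H) \<or> dist_int (\<theta> k l) \<ge> C / real H"
      proof -
        have "\<bar>real_of_int (int D * (int (k i) - int (l i)))\<bar> \<le> C" if "i \<in> {1..d}" for i
        proof -
          have "k i \<le> R" "l i \<le> R" using kl that by (auto simp: bump_freqs_def PiE_iff)
          then have "\<bar>real (k i) - real (l i)\<bar> \<le> real R" by linarith
          then have "real D * \<bar>real (k i) - real (l i)\<bar> \<le> real D * real R"
            by (intro mult_left_mono) auto
          then show ?thesis using CR by (simp add: abs_mult)
        qed
        then show ?thesis unfolding \<theta>_def
          by (intro dich[unfolded dichotomy_def, rule_format, of "\<lambda>i. int D * (int (k i) - int (l i))"])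
      qed
      then have "- 2 * real H / C \<le> T k l"
      proof
        \<comment> \<open>Since \<open>q \<le> 2 * H\<close>, the phase drifts by at most
          \<open>2 / C \<le> 1 / 4\<close> from the integers, so every single term is
          nonnegative.\<close>
        assume small: "dist_int (\<theta> k l) \<le> 1 / (C * real H)"
        have "0 \<le> Re (circ_exp (real q * \<theta> k l))" if "q \<in> {a..<b}" for q
        proof (rule Re_circ_exp_nonneg)
          have "real q \<le> real (q * D)" unfolding of_nat_le_iff using D by simp
          also have "\<dots> \<le> 2 * real H"
            using q(2)[OF that] \<delta> mult_right_mono[of "1 + \<delta>" 2 "real H"] by linarith
          finally have "real q * dist_int (\<theta> k l) \<le> 2 * real H * (1 / (C * real H))"
            using small by (intro mult_mono) (auto simp: dist_int_def)
          also have "\<dots> = 2 / C" using H0 by simp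
          also have "\<dots> \<le> 1 / 4" using C8 by (simp add: field_simps)
          finally show "real q * dist_int (\<theta> k l) \<le> 1 / 4" .
        qed
        then have "0 \<le> T k l" unfolding T_def by (rule sum_nonneg)
        moreover have "- 2 * real H / C \<le> 0" using C8 by (simp add: field_simps)
        ultimately show ?thesis by linarith
      next
        assume large: "dist_int (\<theta> k l) \<ge> C / real H"
        let ?S = "\<Sum>q=a..<b. circ_exp (real q * \<theta> k l)"
        have "cmod ?S * (C / real H) \<le> cmod ?S * dist_int (\<theta> k l)"
          using large by (intro mult_left_mono) auto
        also have "\<dots> \<le> 2" by (rule norm_circ_exp_geometric_sum[OF ab])
        finally have "cmod ?S \<le> 2 * real H / C" using C8 H0 by (simp add: field_simps)
        moreover have "T k l = Re ?S" by (simp add: T_def)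
        ultimately show ?thesis using abs_Re_le_cmod[of ?S] by simp
      qed
      then show ?thesis using False by simp
    qed
    have "(\<Sum>q=a..<b. (cmod (bump d R (?x q)))\<^sup>2)
        = (\<Sum>q=a..<b. \<Sum>k\<in>?K. \<Sum>l\<in>?K. ?p k * ?p l * Re (circ_exp (real q * \<theta> k l)))"
      unfolding norm_bump_squared \<theta>_def by (simp add: sum_distrib_left mult_ac)
    also have "\<dots> = (\<Sum>k\<in>?K. \<Sum>q=a..<b. \<Sum>l\<in>?K. ?p k * ?p l * Re (circ_exp (real q * \<theta> k l)))"
      by (rule sum.swap)
    also have "\<dots> = (\<Sum>k\<in>?K. \<Sum>l\<in>?K. \<Sum>q=a..<b. ?p k * ?p l * Re (circ_exp (real q * \<theta> k l)))"
      by (intro sum.cong refl sum.swap)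
    also have "\<dots> = (\<Sum>k\<in>?K. \<Sum>l\<in>?K. ?p k * ?p l * T k l)"
      by (simp add: T_def sum_distrib_left)
    also have "\<dots> \<ge> (\<Sum>k\<in>?K. \<Sum>l\<in>?K. ?p k * ?p l * ((if k = l then L else 0) - 2 * real H / C))"
      by (intro sum_mono mult_left_mono T mult_nonneg_nonneg bump_weight_nonneg)
    also have "(\<Sum>k\<in>?K. \<Sum>l\<in>?K. ?p k * ?p l * ((if k = l then L else 0) - 2 * real H / C))
        = (\<Sum>k\<in>?K. \<Sum>l\<in>?K. if k = l then ?p k * ?p l * L else 0)
          - (\<Sum>k\<in>?K. \<Sum>l\<in>?K. ?p k * ?p l * (2 * real H / C))"
      unfolding sum_subtractf[symmetric] by (intro sum.cong refl) (simp add: algebra_simps)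
    \<comment> \<open>The weights sum to 1, so the off-diagonal errors do not accumulate with the
      number of frequencies.\<close>
    also have "(\<Sum>k\<in>?K. \<Sum>l\<in>?K. ?p k * ?p l * (2 * real H / C)) = 2 * real H / C"
      unfolding sum_distrib_right[symmetric] sum_distrib_left[symmetric] sum_bump_weight by simp
    also have "(\<Sum>k\<in>?K. \<Sum>l\<in>?K. if k = l then ?p k * ?p l * L else 0)
        = (\<Sum>k\<in>?K. (?p k)\<^sup>2) * L"
      by (simp add: sum_distrib_right power2_eq_square)
    finally have "(\<Sum>k\<in>?K. (?p k)\<^sup>2) * L - 2 * real H / C \<le> (\<Sum>q=a..<b. (cmod (bump d R (?x q)))\<^sup>2)" .
    also have "\<dots> \<le> (\<Sum>q=a..<b. \<rho> ^ R)" by (intro sum_mono upper)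
    also have "\<dots> = L * \<rho> ^ R" using ab by (simp add: L_def of_nat_diff)
    also have "\<dots> < L * (1 / (2 * V))" using R L0 by (intro mult_strict_left_mono)
    finally have 1: "(\<Sum>k\<in>?K. (?p k)\<^sup>2) * L - 2 * real H / C < L / (2 * V)" by simp
    have 2: "L / V \<le> (\<Sum>k\<in>?K. (?p k)\<^sup>2) * L"
      using mult_right_mono[OF sum_bump_weight_squared[of R d], of L] L0 unfolding V_def by simp
    have "2 * real H / C \<le> 2 * real H / (8 * real D * V / \<delta>)"
      using CV C8 D V \<delta> H0 by (intro divide_left_mono mult_pos_pos divide_pos_pos) auto
    also have "\<dots> = (\<delta> * real H / (2 * real D)) / (2 * V)" using \<delta> by simp
    also have "\<dots> \<le> L / (2 * V)" using L V by (intro divide_right_mono) auto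
    finally have 3: "2 * real H / C \<le> L / (2 * V)" .
    have "L / V = L / (2 * V) + L / (2 * V)" by simp
    then show False using 1 2 3 by linarith
  qed
  show ?thesis
    by (rule exI[of _ C], rule conjI, use C8 in linarith, rule exI[of _ H\<^sub>0], use main in blast)
qed

subsection \<open>Negligible sets of windows\<close>

text \<open>Densities are taken in the full range up to \<open>N s\<close>, a denominator free of
  \<open>H s\<close>, so exceptional sets of different shifts can simply be united.\<close>

definition negligible_windows :: "(nat \<Rightarrow> nat) \<Rightarrow> (nat \<Rightarrow> nat \<Rightarrow> bool) \<Rightarrow> bool" where
  "negligible_windows N A \<longleftrightarrow> (\<lambda>s. real (card {n \<in> {1..N s}. A s n}) / real (N s)) \<longlonglongrightarrow> 0"

lemma negligible_windows_disj:
  assumes "negligible_windows N A" "negligible_windows N B"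
  shows "negligible_windows N (\<lambda>s n. A s n \<or> B s n)"
  unfolding negligible_windows_def
proof (rule tendsto_sandwich[OF _ _ tendsto_const])
  show "(\<lambda>s. real (card {n \<in> {1..N s}. A s n}) / real (N s)
      + real (card {n \<in> {1..N s}. B s n}) / real (N s)) \<longlonglongrightarrow> 0"
    using tendsto_add[OF assms[unfolded negligible_windows_def]] by simp
  have "card {n \<in> {1..N s}. A s n \<or> B s n}
      \<le> card {n \<in> {1..N s}. A s n} + card {n \<in> {1..N s}. B s n}" for s
    by (rule order_trans[OF card_mono card_Un_le]) auto
  then show "\<forall>\<^sub>F s in sequentially. real (card {n \<in> {1..N s}. A s n \<or> B s n}) / real (N s)
      \<le> real (card {n \<in> {1..N s}. A s n}) / real (N s)
      + real (card {n \<in> {1..N s}. B s n}) / real (N s)"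
    unfolding add_divide_distrib[symmetric] of_nat_add[symmetric]
    by (intro always_eventually allI divide_right_mono of_nat_mono) auto
qed auto

text \<open>The map sending \<open>n\<close> to \<open>n + t s - 1\<close> is injective on
  \<open>n \<ge> 2\<close>, and at most \<open>1 + t s\<close> points are 1 or are carried out of
  range. The \<open>- 1\<close> appears because a window with base point \<open>a\<close> is read at
  \<open>a + 1, ..., a + H\<close>.\<close>

lemma negligible_windows_shift:
  assumes A: "negligible_windows N A" and t: "(\<lambda>s. real (t s) / real (N s)) \<longlonglongrightarrow> 0"
    and N: "(\<lambda>s. 1 / real (N s)) \<longlonglongrightarrow> 0"
  shows "negligible_windows N (\<lambda>s n. n \<le> 1 \<or> N s + 1 < n + t s \<or> A s (n + t s - 1))"
  unfolding negligible_windows_def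
proof (rule tendsto_sandwich[OF _ _ tendsto_const])
  show "(\<lambda>s. 1 / real (N s) + real (t s) / real (N s)
      + real (card {n \<in> {1..N s}. A s n}) / real (N s)) \<longlonglongrightarrow> 0"
    using tendsto_add[OF tendsto_add[OF N t] A[unfolded negligible_windows_def]] by simp
  have "card {n \<in> {1..N s}. n \<le> 1 \<or> N s + 1 < n + t s \<or> A s (n + t s - 1)}
      \<le> 1 + t s + card {n \<in> {1..N s}. A s n}" for s
  proof -
    let ?B = "{n \<in> {2..N s}. n + t s \<le> N s + 1 \<and> A s (n + t s - 1)}"
    have "card {n \<in> {1..N s}. n \<le> 1 \<or> N s + 1 < n + t s \<or> A s (n + t s - 1)}
        \<le> card ({1} \<union> {N s + 1 - t s<..N s} \<union> ?B)"
      by (rule card_mono) auto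
    also have "\<dots> \<le> card ({1::nat} \<union> {N s + 1 - t s<..N s}) + card ?B" by (rule card_Un_le)
    also have "card ({1::nat} \<union> {N s + 1 - t s<..N s}) \<le> card {1::nat} + card {N s + 1 - t s<..N s}"
      by (rule card_Un_le)
    also have "\<dots> \<le> 1 + t s" by simp
    also have "card ?B \<le> card {n \<in> {1..N s}. A s n}"
      by (rule card_inj_on_le[of "\<lambda>n. n + t s - 1"]) (auto simp: inj_on_def)
    finally show ?thesis by simp
  qed
  then have le: "real (card {n \<in> {1..N s}. n \<le> 1 \<or> N s + 1 < n + t s \<or> A s (n + t s - 1)})
      \<le> real (1 + t s + card {n \<in> {1..N s}. A s n})" for s
    by (rule of_nat_mono)
  show "\<forall>\<^sub>F s in sequentially.
      real (card {n \<in> {1..N s}. n \<le> 1 \<or> N s + 1 < n + t s \<or> A s (n + t s - 1)}) / real (N s)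
      \<le> 1 / real (N s) + real (t s) / real (N s) + real (card {n \<in> {1..N s}. A s n}) / real (N s)"
    unfolding add_divide_distrib[symmetric]
    by (intro always_eventually allI divide_right_mono) (simp_all only: of_nat_0_le_iff le[unfolded of_nat_add of_nat_1])
qed auto

text \<open>Passing from \<open>N s + 1 - H s\<close> base points to \<open>N s\<close> adds at most
  \<open>H s\<close> of them, a vanishing proportion by \<open>prec H N\<close>.\<close>

lemma almost_all_windows_imp_negligible:
  assumes P: "almost_all_windows N H P" and HN: "prec H N"
    and H: "\<And>s. s \<ge> 1 \<Longrightarrow> H s \<ge> 1" and N: "\<And>s. s \<ge> 1 \<Longrightarrow> N s \<ge> 1"
  shows "negligible_windows N (\<lambda>s n. \<not> P s n)"
  unfolding negligible_windows_def
proof (rule tendsto_sandwich[OF _ _ tendsto_const])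
  let ?c = "\<lambda>s. real (card {n \<in> {1..N s + 1 - H s}. P s n})"
  show "(\<lambda>s. (1 - ?c s / real (N s + 1 - H s)) + real (H s) / real (N s)) \<longlonglongrightarrow> 0"
    using tendsto_add[OF tendsto_diff[OF tendsto_const[of 1] P[unfolded almost_all_windows_def]]
        HN[unfolded prec_def]] by simp
  have "\<forall>\<^sub>F s in sequentially. real (H s) / real (N s) < 1"
    using HN unfolding prec_def by (rule order_tendstoD) simp
  then show "\<forall>\<^sub>F s in sequentially. real (card {n \<in> {1..N s}. \<not> P s n}) / real (N s)
      \<le> (1 - ?c s / real (N s + 1 - H s)) + real (H s) / real (N s)"
    using eventually_ge_at_top[of 1]
  proof eventually_elim
    case (elim s)
    have N0: "N s \<ge> 1" and H0: "H s \<ge> 1" using elim N H by auto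
    have HN: "H s < N s" using elim(1) N0 by (simp add: divide_less_eq)
    define M where "M = N s + 1 - H s"
    have M: "1 \<le> M" "M \<le> N s" "real (N s) - real M \<le> real (H s)" using HN H0 by (auto simp: M_def)
    define u where "u = card {n \<in> {1..M}. \<not> P s n}"
    have "card {n \<in> {1..M}. P s n} + u = card ({n \<in> {1..M}. P s n} \<union> {n \<in> {1..M}. \<not> P s n})"
      unfolding u_def by (rule card_Un_disjoint[symmetric]) auto
    also have "{n \<in> {1..M}. P s n} \<union> {n \<in> {1..M}. \<not> P s n} = {1..M}" by auto
    finally have c: "?c s = real M - real u" unfolding M_def[symmetric] by simp
    have "card {n \<in> {1..N s}. \<not> P s n} \<le> card ({n \<in> {1..M}. \<not> P s n} \<union> {M<..N s})"
      by (rule card_mono) auto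
    also have "\<dots> \<le> u + card {M<..N s}" unfolding u_def by (rule card_Un_le)
    finally have "real (card {n \<in> {1..N s}. \<not> P s n}) \<le> real u + real (H s)"
      using M by simp
    then have "real (card {n \<in> {1..N s}. \<not> P s n}) / real (N s) \<le> real u / real (N s) + real (H s) / real (N s)"
      by (simp add: divide_right_mono flip: add_divide_distrib)
    also have "real u / real (N s) \<le> real u / real M"
      using M by (intro divide_left_mono) auto
    also have "real u / real M = 1 - ?c s / real M"
      unfolding c using M by (simp add: diff_divide_distrib)
    finally show ?case unfolding M_def by simp
  qed
qed auto

section \<open>Gluing windows and averaging over them\<close>

text \<open>Consecutive windows of step \<open>H - 1\<close> share an endpoint, so their constants
  agree; four of them reach \<open>n + 3 * H - 1\<close> exactly when \<open>H \<ge> 3\<close>.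
  Length \<open>3 * H\<close> is what \<open>n + h + q\<close> can span for \<open>h < H\<close> and
  \<open>q \<le> 2 * H\<close>.\<close>

lemma constant_on_overlapping_windows:
  fixes g :: "nat \<Rightarrow> 'a"
  assumes H: "H \<ge> 3" and n: "n \<ge> 2" and m: "n \<le> m" "m < n + 3 * H"
    and win: "\<And>k. k < 4 \<Longrightarrow> (\<lambda>h. g (n + k * (H - 1) - 1 + h)) constant_on {1..H}"
  shows "g m = g n"
proof -
  have win': "g a = g b"
    if kab: "k < 4" "a \<in> {n + k * (H - 1)..n + Suc k * (H - 1)}" "b \<in> {n + k * (H - 1)..n + Suc k * (H - 1)}" for k a b
  proof -
    let ?o = "n + k * (H - 1) - 1"
    obtain y where "\<forall>h\<in>{1..H}. g (?o + h) = y" using win[OF kab(1)] by (auto simp: constant_on_def)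
    moreover have "a - ?o \<in> {1..H}" "b - ?o \<in> {1..H}" "?o + (a - ?o) = a" "?o + (b - ?o) = b"
      using kab n H by auto
    ultimately show ?thesis by metis
  qed
  have base: "g (n + k * (H - 1)) = g n" if "k \<le> 3" for k
    using that
  proof (induction k)
    case (Suc k)
    then show ?case using win'[of k "n + Suc k * (H - 1)" "n + k * (H - 1)"] by auto
  qed simp
  define k where "k = (m - n) div (H - 1)"
  have "m - n < 4 * (H - 1) + 1" using m H by auto
  show ?thesis
  \<comment> \<open>The right endpoint of the last window is treated apart, because the quotient
    \<open>k\<close> would there be 4.\<close>
  proof (cases "m - n = 4 * (H - 1)")
    case True
    then have "m = n + Suc 3 * (H - 1)" using m by simp
    then have "g m = g (n + 3 * (H - 1))" by (intro win'[of 3]) auto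
    then show ?thesis using base[of 3] by simp
  next
    case False
    then have k: "k < 4" unfolding k_def
      using \<open>m - n < 4 * (H - 1) + 1\<close> H by (intro less_mult_imp_div_less) auto
    have "k * (H - 1) \<le> m - n" "m - n \<le> Suc k * (H - 1)"
      unfolding k_def using H dividend_less_div_times[of "H - 1" "m - n"] by (auto simp: add.commute)
    then have "m \<in> {n + k * (H - 1)..n + Suc k * (H - 1)}" using m by auto
    then have "g m = g (n + k * (H - 1))" using k by (intro win'[of k]) auto
    then show ?thesis using base[of k] k by simp
  qed
qed

text \<open>Outside \<open>G\<close> the inner average is at most 1. Inside, each of the two error
  sums is covered by \<open>3 * H\<close> translates of \<open>E\<close>, and each translate sums to
  at most the total of \<open>E\<close>; dividing by \<open>H\<close> leaves the factor 6.\<close>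

lemma window_average_bound:
  fixes f E :: "nat \<Rightarrow> real" and q :: "nat \<Rightarrow> nat"
  assumes H: "H \<ge> 1" and f: "\<And>n. n \<ge> 1 \<Longrightarrow> f n \<in> {0..1}"
    and E: "\<And>n. 0 \<le> E n" and \<eta>: "0 \<le> \<eta>"
    and G: "G \<subseteq> {1..N}" "\<And>n. n \<in> G \<Longrightarrow> n + 3 * H \<le> N + 1"
    and q: "\<And>n. q n \<le> 2 * H"
    and close: "\<And>n h. n \<in> G \<Longrightarrow> h < H \<Longrightarrow>
      \<bar>f (n + h) - f (n + h + q n)\<bar> \<le> \<eta> + E (n + h) + E (n + h + q n)"
  shows "(\<Sum>n=1..N. 1 / real H * (\<Sum>h=0..<H. \<bar>f (n + h) - f (n + h + q n)\<bar>))
    \<le> real N * \<eta> + real (card ({1..N} - G)) + 6 * (\<Sum>n=1..N. E n)"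
proof -
  let ?F = "\<lambda>n. 1 / real H * (\<Sum>h=0..<H. \<bar>f (n + h) - f (n + h + q n)\<bar>)"
  let ?B = "\<lambda>n. 2 / real H * (\<Sum>m<3*H. E (n + m))"
  have bad: "?F n \<le> 1" if "n \<ge> 1" for n
  proof -
    have "\<bar>f (n + h) - f (n + h + q n)\<bar> \<le> 1" for h
      using f[of "n + h"] f[of "n + h + q n"] that by auto
    then have "(\<Sum>h=0..<H. \<bar>f (n + h) - f (n + h + q n)\<bar>) \<le> (\<Sum>h=0..<H. 1)" by (intro sum_mono)
    then show ?thesis using H by (simp add: divide_le_eq)
  qed
  have good: "?F n \<le> \<eta> + ?B n" if n: "n \<in> G" for n
  proof -
    have E1: "(\<Sum>h=0..<H. E (n + h)) \<le> (\<Sum>m<3*H. E (n + m))"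
      by (intro sum_mono2) (auto simp: E)
    have "(\<Sum>h=0..<H. E (n + h + q n)) = (\<Sum>m=q n..<H + q n. E (n + m))"
      using sum.shift_bounds_nat_ivl[of "\<lambda>m. E (n + m)" 0 "q n" H] by (simp add: ac_simps)
    also have "\<dots> \<le> (\<Sum>m<3*H. E (n + m))"
      using q[of n] by (intro sum_mono2) (auto simp: E)
    finally have E2: "(\<Sum>h=0..<H. E (n + h + q n)) \<le> (\<Sum>m<3*H. E (n + m))" .
    have "(\<Sum>h=0..<H. \<bar>f (n + h) - f (n + h + q n)\<bar>)
        \<le> (\<Sum>h=0..<H. \<eta> + E (n + h) + E (n + h + q n))"
      using close[OF n] by (intro sum_mono) auto
    also have "\<dots> \<le> real H * \<eta> + 2 * (\<Sum>m<3*H. E (n + m))"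
      using E1 E2 by (simp add: sum.distrib)
    finally have "?F n \<le> 1 / real H * (real H * \<eta> + 2 * (\<Sum>m<3*H. E (n + m)))"
      by (intro mult_left_mono) auto
    then show ?thesis using H by (simp add: field_simps)
  qed
  have "(\<Sum>n\<in>{1..N} - G. ?F n) \<le> (\<Sum>n\<in>{1..N} - G. 1)"
    by (intro sum_mono bad) auto
  then have out: "(\<Sum>n\<in>{1..N} - G. ?F n) \<le> real (card ({1..N} - G))" by simp
  have shift: "(\<Sum>n\<in>G. E (n + m)) \<le> (\<Sum>n=1..N. E n)" if m: "m < 3 * H" for m
  proof -
    have "(\<Sum>n\<in>G. E (n + m)) = (\<Sum>n\<in>(\<lambda>n. n + m) ` G. E n)"
      by (subst sum.reindex) auto
    also have "\<dots> \<le> (\<Sum>n=1..N. E n)"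
    proof (intro sum_mono2)
      show "(\<lambda>n. n + m) ` G \<subseteq> {1..N}" using G(1) G(2) m by fastforce
    qed (auto simp: E)
    finally show ?thesis .
  qed
  have "(\<Sum>n\<in>G. ?F n) \<le> (\<Sum>n\<in>G. \<eta> + ?B n)" by (intro sum_mono good)
  also have "\<dots> = real (card G) * \<eta> + 2 / real H * (\<Sum>m<3*H. \<Sum>n\<in>G. E (n + m))"
    unfolding sum.distrib sum_distrib_left[symmetric] by (subst sum.swap) simp
  also have "\<dots> \<le> real N * \<eta> + 2 / real H * (\<Sum>m<3*H. \<Sum>n=1..N. E n)"
    using card_mono[OF _ G(1)] \<eta> shift
    by (intro add_mono mult_right_mono mult_left_mono sum_mono) auto
  also have "2 / real H * (\<Sum>m<3*H. \<Sum>n=1..N. E n) = 6 * (\<Sum>n=1..N. E n)"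
    using H by simp
  finally have ins: "(\<Sum>n\<in>G. ?F n) \<le> real N * \<eta> + 6 * (\<Sum>n=1..N. E n)" .
  have "(\<Sum>n=1..N. ?F n) = (\<Sum>n\<in>{1..N} - G. ?F n) + (\<Sum>n\<in>G. ?F n)"
    using G by (intro sum.subset_diff) auto
  then show ?thesis using out ins by linarith
qed

subsection \<open>Almost periods of structured functions\<close>

text \<open>The statement at fixed quality \<open>1 / j\<close>. The allowed error is split into
  thirds: the change of the trigonometric sum, the bad base points, and the approximation
  error.\<close>

lemma structured_almost_periods:
  fixes f :: "nat \<Rightarrow> real" and N H :: "nat \<Rightarrow> nat" and j :: nat
  assumes f: "\<And>n. n \<ge> 1 \<Longrightarrow> f n \<in> {0..1}"
    and N: "\<And>s. s \<ge> 1 \<Longrightarrow> N s \<ge> 1" and H: "\<And>s. s \<ge> 1 \<Longrightarrow> H s \<ge> 1"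
    and H_inf: "one_prec H" and HN: "prec H N"
    and str: "U2_structured N H f" and j: "j \<ge> 1"
  shows "\<forall>\<^sub>F s in sequentially. \<exists>q :: nat \<Rightarrow> nat.
    (\<forall>n. H s \<le> q n \<and> real (q n) \<le> (1 + 1 / real j) * real (H s) \<and> (\<forall>m\<in>{1..j}. m dvd q n)) \<and>
    1 / real (N s) * (\<Sum>n=1..N s. 1 / real (H s) *
      (\<Sum>h=0..<H s. \<bar>f (n + h) - f (n + h + q n)\<bar>)) \<le> 1 / real j"
proof -
  \<comment> \<open>The approximation error will cost \<open>9 * \<epsilon> = 1 / (4 * j)\<close>,
    within its third.\<close>
  define \<epsilon> where "\<epsilon> = 1 / (36 * real j)"
  have \<epsilon>: "\<epsilon> > 0" using j by (simp add: \<epsilon>_def)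
  obtain d c \<alpha> where d: "d \<ge> 1" and c: "\<And>i n. i \<in> {1..d} \<Longrightarrow> n \<ge> 1 \<Longrightarrow> cmod (c i n) \<le> 1"
    and conv: "convergent (avg N (\<lambda>n.
          (cmod ((\<Sum>i=1..d. c i n * circ_exp (real n * \<alpha> i n)) - complex_of_real (f n)))\<^sup>2))"
    and nrm: "norm2 N (\<lambda>n. (\<Sum>i=1..d. c i n * circ_exp (real n * \<alpha> i n)) - complex_of_real (f n)) \<le> \<epsilon>"
    and win: "\<And>C::real. C \<ge> 1 \<Longrightarrow>
        almost_all_windows N H (\<lambda>s n. \<forall>i\<in>{1..d}. (\<lambda>h. \<alpha> i (n + h)) constant_on {1..H s}) \<and>
        almost_all_windows N H (\<lambda>s n. \<forall>i\<in>{1..d}. (\<lambda>h. c i (n + h)) constant_on {1..H s}) \<and>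
        almost_all_windows N H (\<lambda>s n. dichotomy d C (H s) (\<lambda>i. \<alpha> i n))"
    using str[unfolded U2_structured_def, rule_format, OF \<epsilon>] unfolding dichotomy_def by blast
  define P where "P n = (\<Sum>i=1..d. c i n * circ_exp (real n * \<alpha> i n))" for n
  define E where "E n = cmod (P n - complex_of_real (f n))" for n
  have E0: "0 \<le> E n" for n by (simp add: E_def)
  \<comment> \<open>Each of the \<open>d\<close> terms changes by at most \<delta>, so together they
    use one third; moreover \<open>\<delta> \<le> 1 / j\<close> gives the required upper bound for
    \<open>Q\<close>.\<close>
  define \<delta> where "\<delta> = 1 / (3 * real j * real d)"
  have \<delta>: "0 < \<delta>" using j d by (simp add: \<delta>_def)
  have \<delta>j: "\<delta> \<le> 1 / real j" unfolding \<delta>_def using j d by (simp add: field_simps)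
  have "1 / real j \<le> 1" using j by simp
  then have \<delta>1: "\<delta> \<le> 1" using \<delta>j by linarith
  have d\<delta>: "real d * \<delta> = 1 / (3 * real j)" unfolding \<delta>_def using d by simp
  \<comment> \<open>Taking \<open>D = fact j\<close> makes every \<open>m \<le> j\<close> divide the
    return time.\<close>
  obtain C H\<^sub>0 where C: "C \<ge> 1" and bohr: "\<And>H' \<alpha>'. H' \<ge> H\<^sub>0 \<Longrightarrow> dichotomy d C H' \<alpha>' \<Longrightarrow>
    \<exists>Q. H' \<le> Q \<and> real Q \<le> (1 + \<delta>) * real H' \<and> fact j dvd Q \<and>
       (\<forall>i\<in>{1..d}. cmod (circ_exp (real Q * \<alpha>' i) - 1) \<le> \<delta>)"
    using bohr_return_time[of "fact j" \<delta> d, OF fact_ge_1 \<delta> \<delta>1] by blast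

  define W where "W s n \<longleftrightarrow>
    \<not> (\<forall>i\<in>{1..d}. (\<lambda>h. \<alpha> i (n + h)) constant_on {1..H s}) \<or>
    \<not> (\<forall>i\<in>{1..d}. (\<lambda>h. c i (n + h)) constant_on {1..H s})" for s n
  have W: "negligible_windows N W"
    unfolding W_def using win[OF C] HN H N
    by (intro negligible_windows_disj almost_all_windows_imp_negligible[of N H]) auto
  have V: "negligible_windows N (\<lambda>s n. \<not> dichotomy d C (H s) (\<lambda>i. \<alpha> i n))"
    using win[OF C] HN H N by (intro almost_all_windows_imp_negligible[of N H]) auto
  have HN0: "(\<lambda>s. real (H s) / real (N s)) \<longlonglongrightarrow> 0" using HN by (simp add: prec_def)
  have N_inf: "(\<lambda>s. 1 / real (N s)) \<longlonglongrightarrow> 0"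
  proof (rule tendsto_sandwich[OF _ _ tendsto_const HN0])
    show "\<forall>\<^sub>F s in sequentially. 1 / real (N s) \<le> real (H s) / real (N s)"
      using eventually_ge_at_top[of 1]
      by eventually_elim (use H in \<open>auto intro!: divide_right_mono simp: Suc_le_eq\<close>)
  qed auto
  have t: "(\<lambda>s. real (k * (H s - 1)) / real (N s)) \<longlonglongrightarrow> 0" for k
  proof (rule tendsto_sandwich[OF _ _ tendsto_const])
    show "(\<lambda>s. real k * (real (H s) / real (N s))) \<longlonglongrightarrow> 0"
      using tendsto_mult_left[OF HN0, of "real k"] by simp
    show "\<forall>\<^sub>F s in sequentially. real (k * (H s - 1)) / real (N s) \<le> real k * (real (H s) / real (N s))"
      by (intro always_eventually allI) (auto intro!: divide_right_mono mult_left_mono)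
  qed auto
  have t': "(\<lambda>s. real (3 * H s) / real (N s)) \<longlonglongrightarrow> 0"
    using tendsto_mult_left[OF HN0, of 3] by simp
  define sh where "sh A t s n \<longleftrightarrow> n \<le> 1 \<or> N s + 1 < n + t s \<or> A s (n + t s - 1)"
    for A :: "nat \<Rightarrow> nat \<Rightarrow> bool" and t :: "nat \<Rightarrow> nat" and s n :: nat
  have sh: "negligible_windows N (sh A t)"
    if "negligible_windows N A" "(\<lambda>s. real (t s) / real (N s)) \<longlonglongrightarrow> 0" for A t
    unfolding sh_def by (rule negligible_windows_shift[OF that N_inf])
  \<comment> \<open>The four shifts of \<open>W\<close> feed
    \<open>constant_on_overlapping_windows\<close>. The shift of the empty condition by
    \<open>3 * H s\<close> only records that the range stays below \<open>N s\<close>.\<close>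
  define bad where "bad s n \<longleftrightarrow>
     sh W (\<lambda>s. 0 * (H s - 1)) s n \<or> sh W (\<lambda>s. 1 * (H s - 1)) s n \<or>
     sh W (\<lambda>s. 2 * (H s - 1)) s n \<or> sh W (\<lambda>s. 3 * (H s - 1)) s n \<or>
     sh (\<lambda>_ _. False) (\<lambda>s. 3 * H s) s n \<or> \<not> dichotomy d C (H s) (\<lambda>i. \<alpha> i n)" for s n
  have F: "negligible_windows N (\<lambda>_ _. False)" by (simp add: negligible_windows_def)
  have bad: "negligible_windows N bad"
    unfolding bad_def by (intro negligible_windows_disj sh W t F t' V)

  have ev_bad: "\<forall>\<^sub>F s in sequentially. real (card {n \<in> {1..N s}. bad s n}) / real (N s) < 1 / (3 * real j)"
    using bad unfolding negligible_windows_def by (rule order_tendstoD) (use j in simp)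
  \<comment> \<open>The limit is at most \<open>\<epsilon>\<^sup>2\<close>; the factor 2 leaves room
    for a strict inequality at finite \<open>s\<close>.\<close>
  have ev_E: "\<forall>\<^sub>F s in sequentially. avg N (\<lambda>n. (E n)\<^sup>2) s < 2 * \<epsilon>\<^sup>2"
  proof -
    have "avg N (\<lambda>n. (E n)\<^sup>2) \<longlonglongrightarrow> mean N (\<lambda>n. (E n)\<^sup>2)"
      using conv unfolding mean_def E_def P_def convergent_LIMSEQ_iff .
    moreover have "sqrt (mean N (\<lambda>n. (E n)\<^sup>2)) \<le> \<epsilon>"
      using nrm unfolding norm2_def E_def P_def .
    then have "mean N (\<lambda>n. (E n)\<^sup>2) \<le> \<epsilon>\<^sup>2" by (rule sqrt_le_D)
    then have "mean N (\<lambda>n. (E n)\<^sup>2) < 2 * \<epsilon>\<^sup>2" using \<epsilon> zero_less_power[OF \<epsilon>, of 2] by linarith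
    ultimately show ?thesis by (rule order_tendstoD)
  qed
  have ev_H: "\<forall>\<^sub>F s in sequentially. H s \<ge> max 3 H\<^sub>0"
    using H_inf unfolding one_prec_def filterlim_at_top by blast
  show ?thesis
    using ev_bad ev_E ev_H eventually_ge_at_top[of 1]
  proof eventually_elim
    case (elim s)
    have N1: "N s \<ge> 1" using N elim by auto
    have H3: "H s \<ge> 3" and HH0: "H s \<ge> H\<^sub>0" using elim by auto
    have "\<exists>Q. H s \<le> Q \<and> real Q \<le> (1 + \<delta>) * real (H s) \<and> fact j dvd Q \<and>
       (dichotomy d C (H s) (\<lambda>i. \<alpha> i n) \<longrightarrow> (\<forall>i\<in>{1..d}. cmod (circ_exp (real Q * \<alpha> i n) - 1) \<le> \<delta>))" for n
    proof (cases "dichotomy d C (H s) (\<lambda>i. \<alpha> i n)")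
      case True
      then show ?thesis using bohr[OF HH0 True] by blast
    next
      case False
      \<comment> \<open>Bad base points also need a value in the right range divisible by
        \<open>fact j\<close>; the zero frequency vector supplies one.\<close>
      have "dichotomy d C (H s) (\<lambda>_. 0)" using C by (simp add: dichotomy_def dist_int_def)
      then show ?thesis using bohr[OF HH0] False by blast
    qed
    then obtain q where q: "\<And>n. H s \<le> q n" "\<And>n. real (q n) \<le> (1 + \<delta>) * real (H s)"
        "\<And>n. fact j dvd q n"
      and q_rot: "\<And>n i. dichotomy d C (H s) (\<lambda>i. \<alpha> i n) \<Longrightarrow> i \<in> {1..d} \<Longrightarrow>
         cmod (circ_exp (real (q n) * \<alpha> i n) - 1) \<le> \<delta>"
      by metis
    have q2: "q n \<le> 2 * H s" for n
    proof -
      have "real (q n) \<le> 2 * real (H s)"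
        using q(2)[of n] mult_right_mono[of "1 + \<delta>" 2 "real (H s)"] \<delta>1 by linarith
      then show ?thesis by linarith
    qed
    have qj: "real (q n) \<le> (1 + 1 / real j) * real (H s)" for n
      using q(2)[of n] mult_right_mono[of "1 + \<delta>" "1 + 1 / real j" "real (H s)"] \<delta>j by linarith
    have qd: "m dvd q n" if "m \<in> {1..j}" for m n
      using that q(3)[of n] dvd_fact[of m j] by (auto intro: dvd_trans)
    define G where "G = {n \<in> {1..N s}. \<not> bad s n}"
    have close: "\<bar>f (n + h) - f (n + h + q n)\<bar> \<le> 1 / (3 * real j) + E (n + h) + E (n + h + q n)"
      if n: "n \<in> G" and h: "h < H s" for n h
    proof -
      have n2: "n \<ge> 2" using n by (auto simp: G_def bad_def sh_def)
      have nW: "\<not> W s (n + k * (H s - 1) - 1)" if "k < 4" for k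
      proof -
        have "k = 0 \<or> k = 1 \<or> k = 2 \<or> k = 3" using that by linarith
        then show ?thesis using n unfolding G_def bad_def sh_def by blast
      qed
      have dich: "dichotomy d C (H s) (\<lambda>i. \<alpha> i n)" using n by (auto simp: G_def bad_def)
      have const: "\<alpha> i m = \<alpha> i n" "c i m = c i n" if i: "i \<in> {1..d}" and im: "n \<le> m" "m < n + 3 * H s" for i m
      proof -
        have "(\<lambda>h. \<alpha> i (n + k * (H s - 1) - 1 + h)) constant_on {1..H s} \<and>
          (\<lambda>h. c i (n + k * (H s - 1) - 1 + h)) constant_on {1..H s}" if "k < 4" for k
          using nW[OF that] i unfolding W_def by blast
        then show "\<alpha> i m = \<alpha> i n" "c i m = c i n"
          using constant_on_overlapping_windows[OF H3 n2 im, of "\<alpha> i"]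
            constant_on_overlapping_windows[OF H3 n2 im, of "c i"] by blast+
      qed
      define m where "m = n + h"
      have m: "n \<le> m" "m < n + 3 * H s" "m + q n < n + 3 * H s" using h q2[of n] by (auto simp: m_def)
      \<comment> \<open>With constant coefficient and frequency, moving by \<open>q n\<close> only
        multiplies a term by \<open>circ_exp (q n * \<alpha> i n)\<close>, which is close to
        1.\<close>
      have term_eq: "c i m * circ_exp (real m * \<alpha> i m) - c i (m + q n) * circ_exp (real (m + q n) * \<alpha> i (m + q n))
          = c i n * circ_exp (real m * \<alpha> i n) * (1 - circ_exp (real (q n) * \<alpha> i n))"
        if i: "i \<in> {1..d}" for i
      proof -
        have eq: "c i m = c i n" "\<alpha> i m = \<alpha> i n" "c i (m + q n) = c i n" "\<alpha> i (m + q n) = \<alpha> i n"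
          using m by (intro const[OF i]; simp)+
        show ?thesis unfolding eq of_nat_add distrib_right circ_exp_add
          by (simp add: right_diff_distrib mult.assoc)
      qed
      have "P m - P (m + q n) = (\<Sum>i=1..d. c i m * circ_exp (real m * \<alpha> i m)
          - c i (m + q n) * circ_exp (real (m + q n) * \<alpha> i (m + q n)))"
        by (simp only: P_def sum_subtractf)
      also have "\<dots> = (\<Sum>i=1..d. c i n * circ_exp (real m * \<alpha> i n) * (1 - circ_exp (real (q n) * \<alpha> i n)))"
        by (rule sum.cong[OF refl term_eq])
      also have "cmod \<dots> \<le> (\<Sum>i=1..d. \<delta>)"
      proof (rule sum_norm_le)
        fix i assume i: "i \<in> {1..d}"
        have "cmod (c i n) * cmod (1 - circ_exp (real (q n) * \<alpha> i n)) \<le> 1 * \<delta>"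
          using c[OF i, of n] n2 q_rot[OF dich i] by (intro mult_mono) (auto simp: norm_minus_commute)
        then show "cmod (c i n * circ_exp (real m * \<alpha> i n) * (1 - circ_exp (real (q n) * \<alpha> i n))) \<le> \<delta>"
          by (simp add: norm_mult)
      qed
      also have "(\<Sum>i=1..d. \<delta>) = 1 / (3 * real j)" using d\<delta> by simp
      finally have PP: "cmod (P m - P (m + q n)) \<le> 1 / (3 * real j)" .
      have "\<bar>f m - f (m + q n)\<bar> = cmod (complex_of_real (f m) - complex_of_real (f (m + q n)))"
        by (metis norm_of_real of_real_diff real_norm_def)
      also have "complex_of_real (f m) - complex_of_real (f (m + q n))
          = (P m - P (m + q n)) - (P m - complex_of_real (f m)) + (P (m + q n) - complex_of_real (f (m + q n)))"
        by simp
      also have "cmod \<dots> \<le> cmod (P m - P (m + q n)) + E m + E (m + q n)"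
        unfolding E_def by (rule norm_triangle_le, rule add_right_mono, rule norm_triangle_ineq4)
      finally show ?thesis using PP unfolding m_def by linarith
    qed
    have bound: "(\<Sum>n=1..N s. 1 / real (H s) * (\<Sum>h=0..<H s. \<bar>f (n + h) - f (n + h + q n)\<bar>))
      \<le> real (N s) * (1 / (3 * real j)) + real (card ({1..N s} - G)) + 6 * (\<Sum>n=1..N s. E n)"
    proof (rule window_average_bound)
      show "n + 3 * H s \<le> N s + 1" if "n \<in> G" for n
        using that by (auto simp: G_def bad_def sh_def)
    qed (use H3 f E0 q2 close in \<open>auto simp: G_def\<close>)
    have cb: "real (card ({1..N s} - G)) \<le> real (N s) * (1 / (3 * real j))"
    proof -
      have "{1..N s} - G = {n \<in> {1..N s}. bad s n}" by (auto simp: G_def)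
      then show ?thesis using elim(1) N1 by (simp add: field_simps)
    qed
    have sE: "6 * (\<Sum>n=1..N s. E n) \<le> real (N s) * (1 / (3 * real j))"
    proof -
      \<comment> \<open>This converts the mean square bound into a first moment bound; averaging
        gives \<open>\<epsilon> + \<epsilon> / 2\<close>, whence 9\<epsilon> after the factor
        6.\<close>
      have "E n \<le> (E n)\<^sup>2 / (2 * \<epsilon>) + \<epsilon> / 2" for n
      proof -
        have "0 \<le> (E n - \<epsilon>)\<^sup>2" by simp
        then have "2 * \<epsilon> * E n \<le> (E n)\<^sup>2 + \<epsilon>\<^sup>2" by (simp add: power2_diff algebra_simps)
        then show ?thesis using \<epsilon> by (simp add: field_simps power2_eq_square)
      qed
      then have "(\<Sum>n=1..N s. E n) \<le> (\<Sum>n=1..N s. (E n)\<^sup>2 / (2 * \<epsilon>) + \<epsilon> / 2)" by (intro sum_mono)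
      also have "\<dots> = (\<Sum>n=1..N s. (E n)\<^sup>2) / (2 * \<epsilon>) + real (N s) * (\<epsilon> / 2)"
        by (simp add: sum.distrib sum_divide_distrib)
      also have "(\<Sum>n=1..N s. (E n)\<^sup>2) \<le> real (N s) * (2 * \<epsilon>\<^sup>2)"
        using elim(2) N1 unfolding avg_def by (simp add: divide_less_eq mult.commute)
      then have "(\<Sum>n=1..N s. (E n)\<^sup>2) / (2 * \<epsilon>) \<le> real (N s) * (2 * \<epsilon>\<^sup>2) / (2 * \<epsilon>)"
        using \<epsilon> by (intro divide_right_mono) auto
      also have "real (N s) * (2 * \<epsilon>\<^sup>2) / (2 * \<epsilon>) = real (N s) * \<epsilon>"
        using \<epsilon> by (simp add: power2_eq_square)
      finally have "(\<Sum>n=1..N s. E n) \<le> real (N s) * \<epsilon> + real (N s) * (\<epsilon> / 2)" by simp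
      then have "6 * (\<Sum>n=1..N s. E n) \<le> real (N s) * (9 * \<epsilon>)" by (simp add: algebra_simps)
      also have "\<dots> \<le> real (N s) * (1 / (3 * real j))"
        unfolding \<epsilon>_def using j by (intro mult_left_mono) (auto simp: field_simps)
      finally show ?thesis .
    qed
    have "(\<Sum>n=1..N s. 1 / real (H s) * (\<Sum>h=0..<H s. \<bar>f (n + h) - f (n + h + q n)\<bar>))
        \<le> 3 * (real (N s) * (1 / (3 * real j)))"
      using bound cb sE by linarith
    also have "\<dots> = real (N s) * (1 / real j)" by simp
    finally have "1 / real (N s) * (\<Sum>n=1..N s. 1 / real (H s) *
        (\<Sum>h=0..<H s. \<bar>f (n + h) - f (n + h + q n)\<bar>)) \<le> 1 / real (N s) * (real (N s) * (1 / real j))"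
      by (intro mult_left_mono) auto
    also have "\<dots> = 1 / real j" using N1 by simp
    finally show ?case using q(1) qj qd by blast
  qed
qed

section \<open>Diagonal choice of the quality and assembly over blocks\<close>

text \<open>\<open>J s\<close> is the largest \<open>j \<le> s\<close> whose threshold has been
  passed by \<open>s\<close>. The value 0 keeps the candidate set nonempty and is excluded once
  \<open>J s \<ge> 1\<close>.\<close>

lemma eventually_diagonal:
  fixes P :: "nat \<Rightarrow> nat \<Rightarrow> bool"
  assumes "\<And>j. j \<ge> 1 \<Longrightarrow> eventually (P j) sequentially"
  shows "\<exists>J. filterlim J at_top sequentially \<and> (\<forall>\<^sub>F s in sequentially. J s \<ge> 1 \<and> P (J s) s)"
proof -
  have "\<exists>S. \<forall>j\<ge>1. \<forall>s\<ge>S j. P j s"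
    using assms unfolding eventually_sequentially by metis
  then obtain S where S: "\<And>j s. j \<ge> 1 \<Longrightarrow> s \<ge> S j \<Longrightarrow> P j s" by blast
  define A where "A s = insert 0 {j. 1 \<le> j \<and> j \<le> s \<and> S j \<le> s}" for s
  define J where "J s = Max (A s)" for s
  have fin: "finite (A s)" for s
    by (rule finite_subset[of _ "{..s}"]) (auto simp: A_def)
  have J_in: "J s \<in> A s" for s unfolding J_def using fin by (intro Max_in) (auto simp: A_def)
  have J_ge: "J s \<ge> j" if "j \<ge> 1" "s \<ge> max j (S j)" for j s
    unfolding J_def using fin that by (intro Max_ge) (auto simp: A_def)
  have lim: "filterlim J at_top sequentially"
    unfolding filterlim_at_top
  proof
    fix Z
    show "\<forall>\<^sub>F s in sequentially. Z \<le> J s"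
      using eventually_ge_at_top[of "max (max Z 1) (S (max Z 1))"]
    proof eventually_elim
      case (elim s)
      then show ?case using J_ge[of "max Z 1" s] by auto
    qed
  qed
  have "\<forall>\<^sub>F s in sequentially. 1 \<le> J s"
    using lim unfolding filterlim_at_top by blast
  then have "\<forall>\<^sub>F s in sequentially. J s \<ge> 1 \<and> P (J s) s"
  proof eventually_elim
    case (elim s)
    then show ?case using J_in[of s] S[of "J s" s] by (auto simp: A_def)
  qed
  then show ?thesis using lim by blast
qed

text \<open>Positivity of \<open>q\<close> ensures that a nondivisor exists at all, for instance
  \<open>q + 1\<close>.\<close>

lemma less_least_nondivisor:
  assumes "q \<ge> 1" "\<And>m. m \<in> {1..j} \<Longrightarrow> m dvd q"
  shows "j < least_nondivisor q"
proof -
  have "\<not> Suc q dvd q" using assms by (auto dest: dvd_imp_le)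
  then have "least_nondivisor q \<ge> 1 \<and> \<not> least_nondivisor q dvd q"
    unfolding least_nondivisor_def by (intro LeastI[of "\<lambda>m. m \<ge> 1 \<and> \<not> m dvd q" "Suc q"]) simp
  then show ?thesis using assms(2)[of "least_nondivisor q"] by force
qed

theorem theorem9p7:
  fixes f f_str f_unf :: "nat \<Rightarrow> real" and N H :: "nat \<Rightarrow> nat"
  assumes "\<And>n. n \<ge> 1 \<Longrightarrow> f n \<in> {0..1}"
    and "N 0 = 0"
    and "\<And>s. s \<ge> 1 \<Longrightarrow> N s \<ge> 1"
    and "\<And>s. s \<ge> 1 \<Longrightarrow> H s \<ge> 1"
    and "one_prec H"
    and "prec H N"
    and "(\<lambda>s. real (N s) / real (N (Suc s))) \<longlonglongrightarrow> 0"
    and "U2_good_scale N H f"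
    and "U2_good_decomposition N H f f_str f_unf"
  shows "\<exists>(\<epsilon> :: nat \<Rightarrow> real) (Q :: nat \<Rightarrow> nat).
    \<epsilon> \<longlonglongrightarrow> 0 \<and>
    (\<forall>s\<ge>1. \<forall>n\<in>{N (s - 1) + 1..N s}.
       H s \<le> Q n \<and> real (Q n) \<le> (1 + \<epsilon> s) * real (H s)) \<and>
    filterlim (\<lambda>n. least_nondivisor (Q n)) at_top sequentially \<and>
    (\<lambda>s. 1 / real (N s) * (\<Sum>n=1..N s. 1 / real (H s) *
       (\<Sum>h=0..<H s. \<bar>f_str (n + h) - f_str (n + h + Q n)\<bar>))) \<longlonglongrightarrow> 0"
proof -
  note N = assms(3) and H = assms(4) and ratio = assms(7)
  have g: "\<And>n. n \<ge> 1 \<Longrightarrow> f_str n \<in> {0..1}" and str: "U2_structured N H f_str"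
    using assms(9) unfolding U2_good_decomposition_def by auto
  let ?F = "\<lambda>s n Q. 1 / real (H s) * (\<Sum>h=0..<H s. \<bar>f_str (n + h) - f_str (n + h + Q)\<bar>)"
  have F0: "0 \<le> ?F s n Q" for s n Q by (simp add: sum_nonneg)
  have F1: "?F s n Q \<le> 1" if "n \<ge> 1" "s \<ge> 1" for s n Q
  proof -
    have "\<bar>f_str (n + h) - f_str (n + h + Q)\<bar> \<le> 1" for h
      using g[of "n + h"] g[of "n + h + Q"] that by auto
    then have "(\<Sum>h=0..<H s. \<bar>f_str (n + h) - f_str (n + h + Q)\<bar>) \<le> (\<Sum>h=0..<H s. 1)"
      by (intro sum_mono)
    then show ?thesis using H[OF that(2)] by (simp add: divide_le_eq)
  qed
  define R where "R j s q \<longleftrightarrow>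
    (\<forall>n. H s \<le> q n \<and> real (q n) \<le> (1 + 1 / real j) * real (H s) \<and> (\<forall>m\<in>{1..j}. m dvd q n)) \<and>
    1 / real (N s) * (\<Sum>n=1..N s. ?F s n (q n)) \<le> 1 / real j" for j s and q :: "nat \<Rightarrow> nat"
  define P where "P j s \<longleftrightarrow> (\<exists>q. R j s q)" for j s
  have "eventually (P j) sequentially" if "j \<ge> 1" for j
    unfolding P_def R_def by (rule structured_almost_periods[OF g N H assms(5,6) str that])
  then obtain J where J_inf: "filterlim J at_top sequentially"
    and J: "\<forall>\<^sub>F s in sequentially. J s \<ge> 1 \<and> P (J s) s"
    using eventually_diagonal[of P] by blast
  have "\<forall>\<^sub>F s in sequentially. real (N s) / real (N (Suc s)) < 1"
    using ratio by (rule order_tendstoD) simp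
  then have "\<forall>\<^sub>F s in sequentially. N s < N (Suc s) \<and> J s \<ge> 1 \<and> P (J s) s"
    using J
  proof eventually_elim
    case (elim s)
    then show ?case using N[of "Suc s"] by (simp add: divide_less_eq)
  qed
  then obtain S\<^sub>0 where S0: "\<And>s. s \<ge> S\<^sub>0 \<Longrightarrow> N s < N (Suc s)"
      "\<And>s. s \<ge> S\<^sub>0 \<Longrightarrow> J s \<ge> 1" "\<And>s. s \<ge> S\<^sub>0 \<Longrightarrow> P (J s) s"
    unfolding eventually_sequentially by blast
  have mono0: "N s \<le> N s'" if "S\<^sub>0 \<le> s" "s \<le> s'" for s s'
    using that(2)
  proof (induction rule: dec_induct)
    case (step k)
    then show ?case using S0(1)[of k] that(1) by simp
  qed simp
  have unb: "N (S\<^sub>0 + k) \<ge> k" for k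
  proof (induction k)
    case (Suc k)
    then show ?case using S0(1)[of "S\<^sub>0 + k"] by simp
  qed simp
  text \<open>\<open>N\<close> need not be monotone at small indices, so finitely many \<open>n\<close> may lie in several
    blocks; these all lie below \<open>N S\<^sub>1\<close> and get one large common value.\<close>
  define S\<^sub>1 where "S\<^sub>1 = S\<^sub>0 + Max (N ` {..S\<^sub>0})"
  have S1: "N s \<le> N S\<^sub>1" if "s \<le> S\<^sub>1" for s
  proof (cases "s \<le> S\<^sub>0")
    case True
    then have "N s \<le> Max (N ` {..S\<^sub>0})" by (intro Max_ge) auto
    also have "\<dots> \<le> N S\<^sub>1" unfolding S\<^sub>1_def by (rule unb)
    finally show ?thesis .
  next
    case False
    then show ?thesis using mono0[of s S\<^sub>1] that by simp
  qed
  have S01: "S\<^sub>0 \<le> S\<^sub>1" by (simp add: S\<^sub>1_def)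
  obtain q where "\<And>s. s \<ge> S\<^sub>0 \<Longrightarrow> R (J s) s (q s)"
    using S0(3) unfolding P_def by metis
  then have q: "H s \<le> q s n"
      "real (q s n) \<le> (1 + 1 / real (J s)) * real (H s)"
      "m \<in> {1..J s} \<Longrightarrow> m dvd q s n"
      "1 / real (N s) * (\<Sum>n=1..N s. ?F s n (q s n)) \<le> 1 / real (J s)" if "s \<ge> S\<^sub>0" for s n m
    using that unfolding R_def by blast+
  \<comment> \<open>The index of the block containing \<open>n\<close>, once \<open>n\<close>
    exceeds \<open>N S\<^sub>1\<close>.\<close>
  define \<sigma> where "\<sigma> n = (LEAST s. S\<^sub>1 < s \<and> n \<le> N s)" for n
  define B where "B = Max (H ` {..S\<^sub>1})"
  define Q where "Q n = (if n \<le> N S\<^sub>1 then B else q (\<sigma> n) n)" for n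
  \<comment> \<open>For the finitely many early scales \<open>Q\<close> equals \<open>B\<close>, and
    \<open>H s \<ge> 1\<close> gives \<open>B \<le> (1 + B) * H s\<close>.\<close>
  define \<epsilon> where "\<epsilon> s = (if s \<le> S\<^sub>1 then real B else 1 / real (J s))" for s
  have \<sigma>_eq: "\<sigma> n = s" if "S\<^sub>1 < s" "N (s - 1) < n" "n \<le> N s" for n s
    unfolding \<sigma>_def
  proof (rule Least_equality)
    fix s' assume s': "S\<^sub>1 < s' \<and> n \<le> N s'"
    show "s \<le> s'"
    proof (rule ccontr)
      assume "\<not> s \<le> s'"
      then have "N s' \<le> N (s - 1)" using s' S01 by (intro mono0) auto
      then show False using s' that by simp
    qed
  qed (use that in auto)
  have \<sigma>: "S\<^sub>1 < \<sigma> n \<and> n \<le> N (\<sigma> n)" for n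
    unfolding \<sigma>_def
  proof (rule LeastI)
    have "n \<le> N (S\<^sub>0 + n)" by (rule unb)
    also have "\<dots> \<le> N (Suc S\<^sub>1 + n)" using S01 by (intro mono0) auto
    finally show "S\<^sub>1 < Suc S\<^sub>1 + n \<and> n \<le> N (Suc S\<^sub>1 + n)" by simp
  qed
  have Q_eq: "Q n = q s n" if "S\<^sub>1 < s" "n \<in> {N (s - 1) + 1..N s}" for n s
  proof -
    have "N S\<^sub>1 \<le> N (s - 1)" using that S01 by (intro mono0) auto
    then show ?thesis using that \<sigma>_eq[of s n] by (auto simp: Q_def)
  qed

  have invJ: "(\<lambda>s. 1 / real (J s)) \<longlonglongrightarrow> 0"
    using filterlim_compose[OF lim_1_over_n J_inf] by simp
  have 1: "\<epsilon> \<longlonglongrightarrow> 0"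
  proof (rule Lim_transform_eventually[OF invJ])
    show "\<forall>\<^sub>F s in sequentially. 1 / real (J s) = \<epsilon> s"
      using eventually_gt_at_top[of S\<^sub>1] by eventually_elim (simp add: \<epsilon>_def)
  qed
  have 2: "H s \<le> Q n \<and> real (Q n) \<le> (1 + \<epsilon> s) * real (H s)"
    if s: "s \<ge> 1" and n: "n \<in> {N (s - 1) + 1..N s}" for s n
  proof (cases "s \<le> S\<^sub>1")
    case True
    then have "n \<le> N S\<^sub>1" using S1[OF True] n by simp
    moreover have "H s \<le> B" unfolding B_def using True by (intro Max_ge) auto
    moreover have "real B * 1 \<le> (1 + real B) * real (H s)"
      using H[OF s] by (intro mult_mono) auto
    ultimately show ?thesis using True by (simp add: Q_def \<epsilon>_def)
  next
    case False
    then show ?thesis using Q_eq[of s n] n q(1,2)[of s n] S01 by (simp add: \<epsilon>_def)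
  qed
  have 3: "filterlim (\<lambda>n. least_nondivisor (Q n)) at_top sequentially"
    unfolding filterlim_at_top
  proof
    fix Z
    have "\<forall>\<^sub>F s in sequentially. Z \<le> J s" using J_inf unfolding filterlim_at_top by blast
    then obtain s2 where s2: "\<And>s. s \<ge> s2 \<Longrightarrow> Z \<le> J s" unfolding eventually_sequentially by blast
    show "\<forall>\<^sub>F n in sequentially. Z \<le> least_nondivisor (Q n)"
      using eventually_gt_at_top[of "N (max s2 S\<^sub>1)"]
    proof eventually_elim
      case (elim n)
      have nS1: "n > N S\<^sub>1" using elim mono0[of S\<^sub>1 "max s2 S\<^sub>1"] S01 by simp
      have \<sigma>n: "S\<^sub>1 < \<sigma> n" "n \<le> N (\<sigma> n)" using \<sigma>[of n] by auto
      have "s2 \<le> \<sigma> n"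
      proof (rule ccontr)
        assume "\<not> s2 \<le> \<sigma> n"
        then have "N (\<sigma> n) \<le> N (max s2 S\<^sub>1)" using \<sigma>n S01 by (intro mono0) auto
        then show False using elim \<sigma>n by simp
      qed
      then have "Z \<le> J (\<sigma> n)" by (rule s2)
      also have "J (\<sigma> n) < least_nondivisor (Q n)"
      proof (rule less_least_nondivisor)
        have "1 \<le> H (\<sigma> n)" using \<sigma>n by (intro H) simp
        also have "\<dots> \<le> q (\<sigma> n) n" using \<sigma>n S01 by (intro q) simp
        finally show "1 \<le> Q n" using nS1 by (simp add: Q_def)
        show "m dvd Q n" if "m \<in> {1..J (\<sigma> n)}" for m
          using q(3)[of "\<sigma> n" m n] that nS1 \<sigma>n S01 by (simp add: Q_def)
      qed
      finally show ?case by simp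
    qed
  qed
  \<comment> \<open>Positions up to \<open>N (s - 1)\<close> carry values of \<open>Q\<close> chosen
    for other scales and are bounded trivially; their proportion vanishes by the growth of
    \<open>N\<close>. On the last block \<open>Q\<close> agrees with \<open>q s\<close>, whose sum
    may be extended to the full range because its terms are nonnegative.\<close>
  have 4: "(\<lambda>s. 1 / real (N s) * (\<Sum>n=1..N s. ?F s n (Q n))) \<longlonglongrightarrow> 0"
  proof (rule tendsto_sandwich[OF _ _ tendsto_const])
    have "(\<lambda>s. real (N (s - 1)) / real (N s)) \<longlonglongrightarrow> 0"
      by (subst filterlim_sequentially_Suc[symmetric]) (simp add: ratio)
    then show "(\<lambda>s. real (N (s - 1)) / real (N s) + 1 / real (J s)) \<longlonglongrightarrow> 0"
      using tendsto_add[OF _ invJ] by simp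
    show "\<forall>\<^sub>F s in sequentially. 0 \<le> 1 / real (N s) * (\<Sum>n=1..N s. ?F s n (Q n))"
      by (intro always_eventually allI mult_nonneg_nonneg sum_nonneg F0) auto
    show "\<forall>\<^sub>F s in sequentially. 1 / real (N s) * (\<Sum>n=1..N s. ?F s n (Q n))
        \<le> real (N (s - 1)) / real (N s) + 1 / real (J s)"
      using eventually_gt_at_top[of S\<^sub>1]
    proof eventually_elim
      case (elim s)
      have "N (s - 1) \<le> N s" using elim S01 by (intro mono0) auto
      then have "{1..N s} = {1..N (s - 1)} \<union> {N (s - 1) + 1..N s}" by auto
      then have "(\<Sum>n=1..N s. ?F s n (Q n))
          = (\<Sum>n=1..N (s - 1). ?F s n (Q n)) + (\<Sum>n=N (s - 1) + 1..N s. ?F s n (Q n))"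
        by (simp only:) (rule sum.union_disjoint, auto)
      also have "(\<Sum>n=1..N (s - 1). ?F s n (Q n)) \<le> (\<Sum>n=1..N (s - 1). 1)"
        using elim by (intro sum_mono F1) auto
      also have "(\<Sum>n=N (s - 1) + 1..N s. ?F s n (Q n)) = (\<Sum>n=N (s - 1) + 1..N s. ?F s n (q s n))"
        using elim by (intro sum.cong refl) (simp only: Q_eq)
      also have "\<dots> \<le> (\<Sum>n=1..N s. ?F s n (q s n))"
        by (intro sum_mono2 F0) auto
      finally have "(\<Sum>n=1..N s. ?F s n (Q n)) \<le> real (N (s - 1)) + (\<Sum>n=1..N s. ?F s n (q s n))"
        by simp
      then have "1 / real (N s) * (\<Sum>n=1..N s. ?F s n (Q n))
          \<le> 1 / real (N s) * (real (N (s - 1)) + (\<Sum>n=1..N s. ?F s n (q s n)))"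
        by (intro mult_left_mono) auto
      also have "\<dots> = real (N (s - 1)) / real (N s) + 1 / real (N s) * (\<Sum>n=1..N s. ?F s n (q s n))"
        unfolding distrib_left by simp
      also have "1 / real (N s) * (\<Sum>n=1..N s. ?F s n (q s n)) \<le> 1 / real (J s)"
        using elim S01 by (intro q(4)) simp
      finally show ?case by simp
    qed
  qed
  show ?thesis using 1 2 3 4 by blast
qed

end
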